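(* Let $X$ be a compact metrizable abelian topological group and let $H$ be a countably infinite subgroup of $X$. Then $H$ has a characterizing set, i.e., there is a countably infinite set $B \subseteq \widehat{X}$ such that $H = \mathcal{C}_B(X)$.
   Context: All topological groups are Hausdorff; abelian groups are written additively. $\mathbb{T} = \mathbb{R}/\mathbb{Z}$. For a topological abelian group $X$, $\widehat{X}$ is the group of continuous homomorphisms $X \to \mathbb{T}$. For a countably infinite set $B \subseteq \widehat{X}$, $\mathcal{C}_B(X)$ is the set of all $x \in X$ such that $\langle \varphi(x) : \varphi \in B\rangle$ converges to $0$ in $\mathbb{T}$, i.e., for every neighborhood $U$ of $0$ in $\mathbb{T}$, $\varphi(x) \in U$ for all but finitely many $\varphi \in B$. It is a subgroup of $X$. One says that $B$ characterizes $H$ (is a characterizing set for $H$) if $H = \mathcal{C}_B(X)$. *)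

theory Defs
  imports "HOL-Analysis.Analysis"
begin

section \<open>The group \<open>\<real>/\<int>\<close> with the quotient topology\<close>

quotient_type circle = real / "\<lambda>x y. x - y \<in> \<int>"
  morphisms rep_circle to_circle
proof (rule equivpI)
  show "reflp (\<lambda>x y::real. x - y \<in> \<int>)"
    by (simp add: reflp_def)
  show "symp (\<lambda>x y::real. x - y \<in> \<int>)"
  proof (rule sympI)
    fix x y :: real
    assume "x - y \<in> \<int>"
    then have "- (x - y) \<in> \<int>" by (rule Ints_minus)
    then show "y - x \<in> \<int>" by simp
  qed
  show "transp (\<lambda>x y::real. x - y \<in> \<int>)"
  proof (rule transpI)
    fix x y z :: real
    assume "x - y \<in> \<int>" "y - z \<in> \<int>"
    then have "(x - y) + (y - z) \<in> \<int>" by (rule Ints_add)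
    then show "x - z \<in> \<int>" by simp
  qed
qed

instantiation circle :: ab_group_add
begin

lift_definition zero_circle :: circle is "0::real" .

lift_definition plus_circle :: "circle \<Rightarrow> circle \<Rightarrow> circle" is "(+) :: real \<Rightarrow> real \<Rightarrow> real"
proof -
  fix a b c d :: real
  assume "a - b \<in> \<int>" "c - d \<in> \<int>"
  then have "(a - b) + (c - d) \<in> \<int>" by (rule Ints_add)
  then show "(a + c) - (b + d) \<in> \<int>" by (simp add: algebra_simps)
qed

lift_definition uminus_circle :: "circle \<Rightarrow> circle" is "uminus :: real \<Rightarrow> real"
proof -
  fix a b :: real
  assume "a - b \<in> \<int>"
  then have "- (a - b) \<in> \<int>" by (rule Ints_minus)
  then show "- a - - b \<in> \<int>" by simp
qed

lift_definition minus_circle :: "circle \<Rightarrow> circle \<Rightarrow> circle" is "(-) :: real \<Rightarrow> real \<Rightarrow> real"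
proof -
  fix a b c d :: real
  assume "a - b \<in> \<int>" "c - d \<in> \<int>"
  then have "(a - b) - (c - d) \<in> \<int>" by (rule Ints_diff)
  then show "(a - c) - (b - d) \<in> \<int>" by (simp add: algebra_simps)
qed

instance
proof
  fix a b c :: circle
  show "a + b + c = a + (b + c)" by transfer (simp add: algebra_simps)
  show "a + b = b + a" by transfer (simp add: algebra_simps)
  show "0 + a = a" by transfer simp
  show "- a + a = 0" by transfer simp
  show "a - b = a + - b" by transfer simp
qed

end

instantiation circle :: topological_space
begin

definition open_circle :: "circle set \<Rightarrow> bool"
  where "open_circle U \<longleftrightarrow> open (to_circle -` U)"

instance
proof
  show "open (UNIV :: circle set)"
    by (simp add: open_circle_def)
  show "open (S \<inter> T)" if "open S" "open T" for S T :: "circle set"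
    using that by (simp add: open_circle_def vimage_Int open_Int)
  show "open (\<Union>K)" if "\<forall>S\<in>K. open S" for K :: "circle set set"
    using that by (auto simp: open_circle_def vimage_Union)
qed

end

lemma to_circle_eq_iff: "to_circle x = to_circle y \<longleftrightarrow> x - y \<in> \<int>"
  by (rule circle.abs_eq_iff)

lemma surj_to_circle: "\<exists>x. a = to_circle x"
  by (rule exI[of _ "rep_circle a"]) (rule Quotient_abs_rep[OF Quotient_circle, symmetric])

lemma quotient_map_to_circle: "quotient_map euclidean euclidean to_circle"
proof -
  have "range to_circle = UNIV"
    using surj_to_circle unfolding surj_def by (intro allI)
  then show ?thesis
    by (simp add: quotient_map_def open_circle_def vimage_def)
qed

lemma to_circle_add: "to_circle (x + y) = to_circle x + to_circle y"
  by (simp add: plus_circle.abs_eq)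

lemma to_circle_minus: "to_circle (- x) = - to_circle x"
  by (simp add: uminus_circle.abs_eq)

lemma open_to_circle_image:
  assumes "open V"
  shows "open (to_circle ` V)"
proof -
  have "to_circle -` (to_circle ` V) = (\<Union>n\<in>\<int>. (+) n ` V)"
  proof (intro set_eqI iffI)
    fix x assume "x \<in> to_circle -` (to_circle ` V)"
    then obtain v where v: "v \<in> V" "x - v \<in> \<int>"
      by (auto simp: to_circle_eq_iff)
    then have "x = (x - v) + v" by simp
    then show "x \<in> (\<Union>n\<in>\<int>. (+) n ` V)" using v by blast
  next
    fix x assume "x \<in> (\<Union>n\<in>\<int>. (+) n ` V)"
    then obtain n v where "n \<in> \<int>" "v \<in> V" "x = n + v" by auto
    then have "to_circle x = to_circle v" by (simp add: to_circle_eq_iff)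
    then show "x \<in> to_circle -` (to_circle ` V)" using \<open>v \<in> V\<close> by auto
  qed
  then show ?thesis
    using assms by (auto simp: open_circle_def intro!: open_translation)
qed

instance circle :: topological_ab_group_add
proof
  fix a b :: circle
  show "((\<lambda>x. fst x + snd x) \<longlongrightarrow> a + b) (nhds a \<times>\<^sub>F nhds b)"
  proof (rule topological_tendstoI)
    fix S assume S: "open S" "a + b \<in> S"
    obtain x y where xy: "a = to_circle x" "b = to_circle y"
      using surj_to_circle by metis
    have "open ((\<lambda>p. fst p + snd p) -` (to_circle -` S) :: (real \<times> real) set)"
    proof (rule open_vimage)
      show "open (to_circle -` S)"
        using S by (simp add: open_circle_def)
      show "continuous_on UNIV (\<lambda>p. fst p + snd p :: real)"
        by (intro continuous_intros)
    qed
    moreover have "(x, y) \<in> (\<lambda>p. fst p + snd p) -` (to_circle -` S)"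
      using S xy by (simp add: to_circle_add)
    ultimately obtain V W where VW: "open V" "open W" "x \<in> V" "y \<in> W"
      "V \<times> W \<subseteq> (\<lambda>p. fst p + snd p) -` (to_circle -` S)"
      by (rule open_prod_elim) blast
    have "eventually (\<lambda>u. u \<in> to_circle ` V) (nhds a)"
      using VW xy by (intro eventually_nhds_in_open open_to_circle_image) auto
    moreover have "eventually (\<lambda>u. u \<in> to_circle ` W) (nhds b)"
      using VW xy by (intro eventually_nhds_in_open open_to_circle_image) auto
    moreover have "u + v \<in> S" if uv: "u \<in> to_circle ` V" "v \<in> to_circle ` W" for u v
    proof -
      obtain r s where rs: "r \<in> V" "s \<in> W" "u = to_circle r" "v = to_circle s"
        using uv by blast
      then have "(r, s) \<in> (\<lambda>p. fst p + snd p) -` (to_circle -` S)"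
        using VW(5) by blast
      then show ?thesis
        using rs by (simp add: to_circle_add)
    qed
    ultimately show "eventually (\<lambda>p. fst p + snd p \<in> S) (nhds a \<times>\<^sub>F nhds b)"
      unfolding eventually_prod_filter fst_conv snd_conv by blast
  qed
  show "(uminus \<longlongrightarrow> - a) (nhds a)"
  proof (rule topological_tendstoI)
    fix S assume S: "open S" "- a \<in> S"
    obtain x where x: "a = to_circle x"
      using surj_to_circle by metis
    have "to_circle -` (uminus -` S) = uminus -` (to_circle -` S)"
      by (auto simp: to_circle_minus)
    moreover have "open (uminus -` (to_circle -` S))"
    proof (rule open_vimage)
      show "open (to_circle -` S)"
        using S by (simp add: open_circle_def)
      show "continuous_on UNIV (uminus :: real \<Rightarrow> real)"
        by (intro continuous_intros)
    qed
    ultimately have "open (uminus -` S)"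
      by (simp only: open_circle_def)
    then have "eventually (\<lambda>u. u \<in> uminus -` S) (nhds a)"
      using S by (intro eventually_nhds_in_open) auto
    then show "eventually (\<lambda>u. - u \<in> S) (nhds a)" by simp
  qed
qed

instance circle :: t2_space
proof
  fix a b :: circle
  assume "a \<noteq> b"
  obtain x y where xy: "a = to_circle x" "b = to_circle y"
    using surj_to_circle by metis
  have "open (- \<int> :: real set)" "x - y \<in> - \<int>"
    using closed_Ints \<open>a \<noteq> b\<close> xy by (auto simp: to_circle_eq_iff)
  then obtain e where e: "e > 0" "ball (x - y) e \<subseteq> - \<int>"
    by (rule openE)
  have "to_circle ` ball x (e/2) \<inter> to_circle ` ball y (e/2) = {}"
  proof (rule ccontr)
    assume "to_circle ` ball x (e/2) \<inter> to_circle ` ball y (e/2) \<noteq> {}"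
    then obtain u v where "u \<in> ball x (e/2)" "v \<in> ball y (e/2)" "to_circle u = to_circle v"
      by blast
    then have uv: "dist x u < e/2" "dist y v < e/2" "u - v \<in> \<int>"
      by (simp_all add: to_circle_eq_iff)
    then have "u - v \<in> ball (x - y) e"
      unfolding mem_ball dist_real_def by linarith
    then show False using e uv by blast
  qed
  moreover have "a \<in> to_circle ` ball x (e/2)" "b \<in> to_circle ` ball y (e/2)"
    using e xy by auto
  ultimately show "\<exists>U V. open U \<and> open V \<and> a \<in> U \<and> b \<in> V \<and> U \<inter> V = {}"
    by (intro exI[of _ "to_circle ` ball x (e/2)"] exI[of _ "to_circle ` ball y (e/2)"] conjI
        open_to_circle_image open_ball)
qed


section \<open>Characters and characterized subgroups\<close>

definition is_subgroup :: "'a::group_add set \<Rightarrow> bool"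
  where "is_subgroup H \<longleftrightarrow> 0 \<in> H \<and> (\<forall>x\<in>H. \<forall>y\<in>H. x + y \<in> H) \<and> (\<forall>x\<in>H. - x \<in> H)"

definition dual_group :: "('a::topological_ab_group_add \<Rightarrow> circle) set"
  where "dual_group = {\<phi>. Modules.additive \<phi> \<and> continuous_on UNIV \<phi>}"

text \<open>Convergence of \<open>\<langle>\<phi>(x) : \<phi> \<in> B\<rangle>\<close> to \<open>0\<close> is along the cofinite filter on \<open>B\<close>.\<close>

definition char_subgroup :: "('a::topological_ab_group_add \<Rightarrow> circle) set \<Rightarrow> 'a set"
  where "char_subgroup B =
    {x. \<forall>U. open U \<longrightarrow> 0 \<in> U \<longrightarrow> finite {\<phi>\<in>B. \<phi> x \<notin> U}}"

end

theory Submission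
  imports Defs
begin

text \<open>
  Continuous characters separate the points of \<open>X\<close>: given \<open>a \<noteq> 0\<close>, let \<open>f\<close> have
  \<open>L\<^sup>2\<close>-norm \<open>1\<close> with respect to the invariant mean, let \<open>\<phi>\<close> be its autocorrelation, and maximize the
  \<open>L\<^sup>2\<close>-norm of \<open>u = g - g(\<cdot> + a)\<close> where \<open>g\<close> is the convolution of \<open>\<phi>\<close> with a fixed bump function.
  Perturbing \<open>f\<close> to \<open>(f + c f(\<cdot> + b))/\<surd>2\<close> shows that near the maximum \<open>u\<close> is almost an
  eigenfunction of translation by \<open>b\<close> with eigenvalue \<open>\<phi>(b)\<close>, so that every pointwise cluster point
  of a maximizing sequence of the \<open>\<phi>\<close> is a continuous character which is nontrivial at \<open>a\<close>.

  For finite \<open>F \<subseteq> H\<close> let \<open>V(F, e)\<close> be the set of characters that are \<open>e\<close>-close to \<open>1\<close> on \<open>F\<close>. The trigonometric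
  polynomial \<open>\<Prod>h\<in>F. \<bar>(1 + \<phi>(h))/2\<bar>\<^bsup>2N\<^esup>\<close> is exponentially small off \<open>V(F, e)\<close>
  while its mean over the dual decays only polynomially in \<open>N\<close>; hence the points at which
  all characters in \<open>V(F, e)\<close> are close to \<open>1\<close> are among the finitely many differences of exponents
  of this polynomial, which lie in the group generated by \<open>F\<close>. The same holds after
  removing finitely many characters from \<open>V(F, e)\<close>. Exhausting \<open>H\<close> by finite sets \<open>F\<^sub>n\<close> and letting \<open>e\<^sub>n\<close>
  tend to \<open>0\<close>, compactness yields pairwise disjoint finite blocks \<open>B\<^sub>n \<subseteq> V(F\<^sub>n, e\<^sub>n)\<close> such that a point
  at which \<open>B\<^sub>n\<close> is close to \<open>1\<close> lies in \<open>P\<^sub>n + U\<^sub>n\<close>, with \<open>P\<^sub>n \<subseteq> H\<close> finite and \<open>U\<^sub>n\<close> shrinking to \<open>0\<close> so fast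
  that the component in \<open>P\<^sub>n\<close> must be eventually constant. The union of the blocks
  characterizes \<open>H\<close>.
\<close>

section \<open>Invariant means\<close>

text \<open>Lists instead of sets keep multiplicities, so that an average of averages is again an
  average, taken over \<open>list_plus A B\<close>.\<close>

definition avg :: "'g::ab_group_add list \<Rightarrow> ('g \<Rightarrow> 'b::real_normed_vector) \<Rightarrow> 'g \<Rightarrow> 'b"
  where "avg A f x = (\<Sum>a\<leftarrow>A. f (x + a)) /\<^sub>R real (length A)"

text \<open>The mean is the constant that averages of translates approximate uniformly. Being
  phrased through translates alone, it serves both the compact group and its dual.\<close>

definition has_mean :: "('g::ab_group_add \<Rightarrow> 'b::real_normed_vector) \<Rightarrow> 'b \<Rightarrow> bool"
  where "has_mean f c \<longleftrightarrow> (\<forall>e>0. \<exists>A. A \<noteq> [] \<and> (\<forall>x. norm (avg A f x - c) \<le> e))"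

definition list_plus :: "'g::ab_group_add list \<Rightarrow> 'g list \<Rightarrow> 'g list"
  where "list_plus A B = map (\<lambda>(a, b). a + b) (List.product A B)"

lemma sum_list_product:
  "(\<Sum>p\<leftarrow>List.product A B. F p) = (\<Sum>a\<leftarrow>A. \<Sum>b\<leftarrow>B. F (a, b) :: 'b::comm_monoid_add)"
  by (induction A) (simp_all add: o_def)

lemma sum_list_commute:
  "(\<Sum>a\<leftarrow>A. \<Sum>b\<leftarrow>B. F a b) = (\<Sum>b\<leftarrow>B. \<Sum>a\<leftarrow>A. F a b :: 'b::comm_monoid_add)"
  by (induction A) (simp_all add: sum_list_addf)

lemma list_plus_Nil_iff [simp]: "list_plus A B = [] \<longleftrightarrow> A = [] \<or> B = []"
  by (metis (no_types, lifting) length_0_conv length_map length_product list_plus_def mult_is_0)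

lemma scaleR_sum_list: "c *\<^sub>R (\<Sum>a\<leftarrow>A. f a) = (\<Sum>a\<leftarrow>A. c *\<^sub>R (f a :: 'b::real_vector))"
  by (induction A) (simp_all add: scaleR_add_right)

lemma avg_list_plus_eq:
  "avg (list_plus A B) f x
    = (\<Sum>a\<leftarrow>A. \<Sum>b\<leftarrow>B. f (x + a + b)) /\<^sub>R (real (length A) * real (length B))"
  by (simp add: avg_def list_plus_def sum_list_product o_def case_prod_unfold add.assoc)

lemma avg_avg_eq:
  "avg A (avg B f) x
    = (\<Sum>a\<leftarrow>A. \<Sum>b\<leftarrow>B. f (x + a + b)) /\<^sub>R (real (length A) * real (length B))"
  by (simp add: avg_def flip: scaleR_sum_list)

lemma avg_list_plus: "avg (list_plus A B) f x = avg A (avg B f) x"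
  unfolding avg_list_plus_eq avg_avg_eq ..

lemma avg_list_plus': "avg (list_plus A B) f x = avg B (avg A f) x"
  unfolding avg_list_plus_eq avg_avg_eq
  by (subst sum_list_commute) (simp add: ac_simps)

lemma avg_commute: "avg A (avg B f) x = avg B (avg A f) x"
  by (metis avg_list_plus avg_list_plus')

lemma avg_const [simp]:
  assumes "A \<noteq> []"
  shows "avg A (\<lambda>x. c) x = c"
proof -
  have "(\<Sum>a\<leftarrow>A. c) = real (length A) *\<^sub>R c"
    by (induction A) (simp_all add: scaleR_add_left)
  then show ?thesis using assms by (simp add: avg_def)
qed

lemma avg_add: "avg A (\<lambda>x. f x + g x) x = avg A f x + avg A g x"
  by (simp add: avg_def sum_list_addf scaleR_add_right)

lemma avg_bounded_linear:
  assumes "bounded_linear T"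
  shows "avg A (\<lambda>x. T (f x)) x = T (avg A f x)"
proof -
  interpret bounded_linear T by fact
  have "(\<Sum>a\<leftarrow>A. T (f (x + a))) = T (\<Sum>a\<leftarrow>A. f (x + a))"
    by (induction A) (simp_all add: add zero)
  then show ?thesis by (simp add: avg_def scaleR)
qed

lemma avg_diff: "avg A (\<lambda>x. f x - g x) x = avg A f x - avg A g x"
  using avg_add[of A "\<lambda>x. f x - g x" g x] by simp

lemma avg_shift: "avg A (\<lambda>x. f (x + a)) x = avg A f (x + a)"
  by (simp add: avg_def algebra_simps)

lemma norm_avg_le:
  assumes "A \<noteq> []" "\<And>x. norm (f x) \<le> e"
  shows "norm (avg A f x) \<le> e"
proof -
  have "norm (\<Sum>a\<leftarrow>A. f (x + a)) \<le> real (length A) * e"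
  proof (induction A)
    case (Cons a A)
    have "norm (f (x + a) + (\<Sum>a\<leftarrow>A. f (x + a))) \<le> e + real (length A) * e"
      by (rule order.trans[OF norm_triangle_ineq add_mono[OF assms(2) Cons]])
    then show ?case by (simp add: algebra_simps)
  qed simp
  then show ?thesis
    using assms(1) by (simp add: avg_def field_simps)
qed

lemma norm_avg_diff_le:
  assumes "A \<noteq> []" "\<And>x. norm (f x - c) \<le> e"
  shows "norm (avg A f x - c) \<le> e"
  using norm_avg_le[OF assms(1), of "\<lambda>x. f x - c" e x] assms by (simp add: avg_diff)

text \<open>Averages over \<open>A\<close> and \<open>B\<close> commute, and a further average never
  increases the uniform distance to a constant; hence \<open>list_plus A B\<close> serves both
  functions.\<close>

lemma has_mean_common:
  assumes "has_mean f c" "has_mean g d" "e > 0"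
  obtains A where "A \<noteq> []" "\<And>x. norm (avg A f x - c) \<le> e" "\<And>x. norm (avg A g x - d) \<le> e"
proof -
  obtain A where A: "A \<noteq> []" "\<And>x. norm (avg A f x - c) \<le> e"
    using assms(1,3) unfolding has_mean_def by blast
  obtain B where B: "B \<noteq> []" "\<And>x. norm (avg B g x - d) \<le> e"
    using assms(2,3) unfolding has_mean_def by blast
  show ?thesis
  proof (rule that[of "list_plus A B"])
    show "norm (avg (list_plus A B) f x - c) \<le> e" for x
      unfolding avg_list_plus' by (rule norm_avg_diff_le[OF B(1) A(2)])
    show "norm (avg (list_plus A B) g x - d) \<le> e" for x
      unfolding avg_list_plus by (rule norm_avg_diff_le[OF A(1) B(2)])
  qed (use A B in auto)
qed

lemma has_mean_unique:
  assumes "has_mean f c" "has_mean f d"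
  shows "c = d"
proof (rule ccontr)
  assume "c \<noteq> d"
  then have "norm (c - d) / 3 > 0" by simp
  then obtain A where "norm (avg A f 0 - c) \<le> norm (c - d) / 3"
      "norm (avg A f 0 - d) \<le> norm (c - d) / 3"
    using has_mean_common[OF assms] by blast
  moreover have "norm (c - d) \<le> norm (avg A f 0 - c) + norm (avg A f 0 - d)"
    using norm_triangle_ineq4[of "avg A f 0 - d" "avg A f 0 - c"] by (simp add: add.commute)
  ultimately show False using \<open>norm (c - d) / 3 > 0\<close> by linarith
qed

lemma has_mean_const: "has_mean (\<lambda>x. c) c"
  unfolding has_mean_def by (auto intro!: exI[of _ "[0]"])

lemma has_mean_add:
  assumes "has_mean f c" "has_mean g d"
  shows "has_mean (\<lambda>x. f x + g x) (c + d)"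
  unfolding has_mean_def
proof (intro allI impI)
  fix e :: real assume "e > 0"
  then have "e / 2 > 0" by simp
  then obtain A where A: "A \<noteq> []" "\<And>x. norm (avg A f x - c) \<le> e / 2"
      "\<And>x. norm (avg A g x - d) \<le> e / 2"
    using has_mean_common[OF assms] by blast
  have "norm (avg A (\<lambda>x. f x + g x) x - (c + d)) \<le> e" for x
    using norm_triangle_mono[OF A(2)[of x] A(3)[of x]] by (simp add: avg_add algebra_simps)
  then show "\<exists>A. A \<noteq> [] \<and> (\<forall>x. norm (avg A (\<lambda>x. f x + g x) x - (c + d)) \<le> e)"
    using A(1) by blast
qed

lemma has_mean_bounded_linear:
  assumes "bounded_linear T" "has_mean f c"
  shows "has_mean (\<lambda>x. T (f x)) (T c)"
  unfolding has_mean_def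
proof (intro allI impI)
  interpret bounded_linear T by fact
  obtain K where K: "K > 0" "\<And>x. norm (T x) \<le> norm x * K"
    using pos_bounded by blast
  fix e :: real assume "e > 0"
  then have "e / K > 0" using K by simp
  then obtain A where A: "A \<noteq> []" "\<And>x. norm (avg A f x - c) \<le> e / K"
    using assms unfolding has_mean_def by blast
  have "norm (avg A (\<lambda>x. T (f x)) x - T c) \<le> e" for x
  proof -
    have "avg A (\<lambda>x. T (f x)) x - T c = T (avg A f x - c)"
      by (simp add: avg_bounded_linear[OF assms(1)] diff)
    also have "norm \<dots> \<le> norm (avg A f x - c) * K" by (rule K)
    also have "\<dots> \<le> e" using A(2)[of x] K by (simp add: field_simps)
    finally show ?thesis .
  qed
  then show "\<exists>A. A \<noteq> [] \<and> (\<forall>x. norm (avg A (\<lambda>x. T (f x)) x - T c) \<le> e)"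
    using A(1) by blast
qed

lemma has_mean_mult_left:
  fixes f :: "_ \<Rightarrow> 'b::real_normed_algebra"
  shows "has_mean f c \<Longrightarrow> has_mean (\<lambda>x. k * f x) (k * c)"
  by (rule has_mean_bounded_linear[OF bounded_linear_mult_right])

lemma has_mean_diff:
  assumes "has_mean f c" "has_mean g d"
  shows "has_mean (\<lambda>x. f x - g x) (c - d)"
  using has_mean_add[OF assms(1)
      has_mean_bounded_linear[OF bounded_linear_minus[OF bounded_linear_ident] assms(2)]]
  by simp

lemma has_mean_sum:
  assumes "\<And>i. i \<in> I \<Longrightarrow> has_mean (f i) (c i)"
  shows "has_mean (\<lambda>x. \<Sum>i\<in>I. f i x) (\<Sum>i\<in>I. c i)"
  using assms
  by (induction I rule: infinite_finite_induct) (auto intro: has_mean_const has_mean_add)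

lemma has_mean_shift: "has_mean f c \<Longrightarrow> has_mean (\<lambda>x. f (x + a)) c"
  unfolding has_mean_def avg_shift by blast

lemma has_mean_avg:
  assumes "has_mean f c" "B \<noteq> []"
  shows "has_mean (avg B f) c"
  unfolding has_mean_def
proof (intro allI impI)
  fix e :: real assume "e > 0"
  then obtain A where A: "A \<noteq> []" "\<And>x. norm (avg A f x - c) \<le> e"
    using assms(1) unfolding has_mean_def by blast
  have "norm (avg A (avg B f) x - c) \<le> e" for x
    unfolding avg_commute[of A B f x] by (rule norm_avg_diff_le[OF assms(2) A(2)])
  then show "\<exists>A. A \<noteq> [] \<and> (\<forall>x. norm (avg A (avg B f) x - c) \<le> e)"
    using A(1) by blast
qed

lemma has_mean_norm_le:
  assumes "has_mean f c" "\<And>x. norm (f x) \<le> B"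
  shows "norm c \<le> B"
proof (rule field_le_epsilon)
  fix e :: real assume "e > 0"
  then obtain A where A: "A \<noteq> []" "norm (avg A f 0 - c) \<le> e"
    using assms(1) unfolding has_mean_def by blast
  have "norm c \<le> norm (avg A f 0) + norm (avg A f 0 - c)"
    using norm_triangle_ineq4[of "avg A f 0" "avg A f 0 - c"] by simp
  also have "\<dots> \<le> B + e"
    using norm_avg_le[OF A(1) assms(2)] A(2) by (intro add_mono) auto
  finally show "norm c \<le> B + e" .
qed

lemma has_mean_nonneg:
  fixes f :: "_ \<Rightarrow> real"
  assumes "has_mean f c" "\<And>x. 0 \<le> f x"
  shows "0 \<le> c"
proof (rule field_le_epsilon)
  fix e :: real assume "e > 0"
  then obtain A where A: "A \<noteq> []" "norm (avg A f 0 - c) \<le> e"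
    using assms(1) unfolding has_mean_def by blast
  have "0 \<le> avg A f 0"
    unfolding avg_def by (intro scaleR_nonneg_nonneg sum_list_nonneg) (auto intro: assms(2))
  then show "0 \<le> c + e" using A(2) by simp
qed

lemma has_mean_mono:
  fixes f g :: "_ \<Rightarrow> real"
  assumes "has_mean f c" "has_mean g d" "\<And>x. f x \<le> g x"
  shows "c \<le> d"
  using has_mean_nonneg[OF has_mean_diff[OF assms(2,1)]] assms(3) by simp

lemma sum_list_le_one_smaller:
  fixes f :: "'b \<Rightarrow> real"
  assumes "\<And>x. x \<in> set S \<Longrightarrow> f x \<le> t" "s \<in> set S" "f s \<le> r"
  shows "(\<Sum>x\<leftarrow>S. f x) \<le> (real (length S) - 1) * t + r"
  using assms
proof (induction S)
  case (Cons a S)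
  have le: "(\<Sum>x\<leftarrow>S. f x) \<le> real (length S) * t"
    using sum_list_mono[of S f "\<lambda>_. t"] Cons.prems by (simp add: sum_list_triv)
  show ?case
  proof (cases "s \<in> set S")
    case True
    then have "(\<Sum>x\<leftarrow>S. f x) \<le> (real (length S) - 1) * t + r"
      using Cons by simp
    moreover have "f a \<le> t" using Cons.prems by simp
    ultimately show ?thesis by (simp add: algebra_simps)
  next
    case False
    then show ?thesis using Cons.prems le by simp
  qed
qed simp

section \<open>Compact groups: existence and positivity of means\<close>

locale compact_group =
  fixes type :: "'a::{topological_ab_group_add, t2_space} itself"
  assumes compact_UNIV: "compact (UNIV :: 'a set)"
begin

lemma uniform_continuity:
  fixes f :: "'a \<Rightarrow> 'b::metric_space"
  assumes "continuous_on UNIV f" "e > 0"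
  shows "\<forall>\<^sub>F a in nhds 0. \<forall>x. dist (f (x + a)) (f x) < e"
proof -
  define G where "G x p \<longleftrightarrow> open (fst p) \<and> open (snd p) \<and> x \<in> fst p \<and> 0 \<in> snd p
      \<and> (\<forall>y\<in>fst p. \<forall>u\<in>snd p. dist (f (y + u)) (f x) < e / 2)" for x p
  have ex: "\<forall>x. \<exists>p. G x p"
  proof
    fix x
    have "open ((\<lambda>p. f (fst p + snd p)) -` ball (f x) (e / 2))"
      by (intro open_vimage open_ball continuous_on_compose2[OF assms(1)] continuous_intros) auto
    moreover have "(x, 0) \<in> (\<lambda>p. f (fst p + snd p)) -` ball (f x) (e / 2)"
      using assms by simp
    ultimately obtain V W where "open V" "open W" "x \<in> V" "0 \<in> W"
      "V \<times> W \<subseteq> (\<lambda>p. f (fst p + snd p)) -` ball (f x) (e / 2)"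
      by (rule open_prod_elim) blast
    then show "\<exists>p. G x p"
      unfolding G_def by (intro exI[of _ "(V, W)"]) (force simp: dist_commute)
  qed
  from choice[OF ex] obtain P where P: "\<forall>x. G x (P x)" by blast
  define V where "V x = fst (P x)" for x
  define W where "W x = snd (P x)" for x
  have VW: "open (V x)" "open (W x)" "x \<in> V x" "0 \<in> W x" for x
    using P[rule_format, of x] unfolding V_def W_def G_def by simp_all
  have close: "dist (f (y + u)) (f x) < e / 2" if "y \<in> V x" "u \<in> W x" for x y u
    using P[rule_format, of x] that unfolding V_def W_def G_def by simp
  obtain D where D: "finite D" "UNIV \<subseteq> (\<Union>x\<in>D. V x)"
    by (rule compactE_image[OF compact_UNIV, of UNIV V]) (use VW in auto)
  have "\<forall>\<^sub>F a in nhds 0. \<forall>x\<in>D. a \<in> W x"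
    using VW D by (intro eventually_ball_finite ballI eventually_nhds_in_open) auto
  then show ?thesis
  proof eventually_elim
    case (elim a)
    show ?case
    proof
      fix y
      obtain x where x: "x \<in> D" "y \<in> V x" using D by blast
      have "dist (f (y + a)) (f x) < e / 2" "dist (f (y + 0)) (f x) < e / 2"
        using close[OF x(2)] VW(4)[of x] elim x(1) by blast+
      then show "dist (f (y + a)) (f y) < e"
        using dist_triangle_half_r[of "f x" "f (y + a)" e "f y"] by (simp add: dist_commute)
    qed
  qed
qed

text \<open>By compactness. Averaging over such an \<open>S\<close> makes the behaviour of a
  function near one point felt at every point.\<close>

lemma finite_net:
  assumes "open U" "(0::'a) \<in> U"
  obtains S where "S \<noteq> []" "\<And>x. \<exists>s\<in>set S. x + s \<in> U"
proof -
  have "open ((\<lambda>x. x + s) -` U)" for s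
    by (intro open_vimage assms continuous_intros)
  moreover have "UNIV \<subseteq> (\<Union>s\<in>UNIV. (\<lambda>x. x + s) -` U)"
  proof
    fix x :: 'a
    have "x + (- x) \<in> U" using assms by simp
    then show "x \<in> (\<Union>s\<in>UNIV. (\<lambda>x. x + s) -` U)" by blast
  qed
  ultimately obtain D where D: "finite D" "UNIV \<subseteq> (\<Union>s\<in>D. (\<lambda>x. x + s) -` U)"
    by (rule compactE_image[OF compact_UNIV])
  obtain S where S: "set S = D" using finite_list[OF D(1)] by blast
  show ?thesis
  proof (rule that)
    show "S \<noteq> []" using S D by auto
    show "\<exists>s\<in>set S. x + s \<in> U" for x using S D by auto
  qed
qed

lemma bounded_continuous:
  fixes f :: "'a \<Rightarrow> 'b::real_normed_vector"
  assumes "continuous_on UNIV f"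
  shows "\<exists>B>0. \<forall>x. norm (f x) \<le> B"
  using compact_imp_bounded[OF compact_continuous_image[OF assms compact_UNIV]]
  unfolding bounded_pos by auto

text \<open>Let \<open>c\<close> be the infimum of the uniform upper bounds of averages. If an
  average nearly attaining it dipped below \<open>c - e\<close> somewhere, averaging once more over
  a finite net would spread the dip over the whole group and give an upper bound below
  \<open>c\<close>.\<close>

lemma has_mean_exists_real:
  fixes f :: "'a \<Rightarrow> real"
  assumes cont: "continuous_on UNIV f"
  shows "\<exists>c. has_mean f c"
proof -
  define T where "T = {t. \<exists>A. A \<noteq> [] \<and> (\<forall>x. avg A f x \<le> t)}"
  define c where "c = Inf T"
  obtain B where B: "B > 0" "\<And>x. norm (f x) \<le> B"
    using bounded_continuous[OF cont] by auto
  have T_lower: "- B \<le> t" if t: "t \<in> T" for t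
  proof -
    obtain A where A: "A \<noteq> []" "\<forall>x. avg A f x \<le> t"
      using t by (auto simp: T_def)
    have "norm (avg A f 0) \<le> B" by (rule norm_avg_le[OF A(1) B(2)])
    then show ?thesis using A(2)[rule_format, of 0] by simp
  qed
  then have bdd: "bdd_below T" by (meson bdd_below.I)
  have "avg [0] f x \<le> B" for x
    using B(2)[of x] by (simp add: avg_def)
  then have "B \<in> T" unfolding T_def by blast
  then have ne: "T \<noteq> {}" by blast
  have c_le: "c \<le> t" if "t \<in> T" for t
    unfolding c_def by (rule cInf_lower[OF that bdd])
  have "has_mean f c"
    unfolding has_mean_def
  proof (intro allI impI)
    fix e :: real assume e: "e > 0"
    then have "e / 2 > 0" by simp
    from uniform_continuity[OF cont this] obtain U where
      U: "open U" "0 \<in> U" "\<And>a x. a \<in> U \<Longrightarrow> dist (f (x + a)) (f x) < e / 2"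
      unfolding eventually_nhds by blast
    obtain S where S: "S \<noteq> []" "\<And>x. \<exists>s\<in>set S. x + s \<in> U"
      by (rule finite_net[OF U(1,2)]) blast
    define L where "L = real (length S)"
    have L: "L \<ge> 1" using S(1) by (cases S) (auto simp: L_def)
    \<comment> \<open>In the final count one dip of \<open>e / 2\<close> below \<open>c\<close>
      competes with \<open>L - 1\<close> excesses of at most \<open>d\<close>; since
      \<open>L * d = e / 4\<close>, the dip wins.\<close>
    define d where "d = e / (4 * L)"
    have d: "0 < d" "d \<le> e" "L * d = e / 4"
      using e L by (auto simp: d_def field_simps)
    obtain t where t: "t \<in> T" "t < c + d"
      using cInf_lessD[OF ne, of "c + d"] d(1) unfolding c_def by auto
    then obtain A where A: "A \<noteq> []" "\<And>x. avg A f x \<le> t" unfolding T_def by blast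
    \<comment> \<open>Averaging preserves the modulus of continuity, so the net \<open>S\<close>
      could be fixed before \<open>A\<close> was chosen.\<close>
    have osc: "dist (avg A f (x + a)) (avg A f x) \<le> e / 2" if "a \<in> U" for a x
    proof -
      have "norm (avg A (\<lambda>x. f (x + a) - f x) x) \<le> e / 2"
        using U(3)[OF that] by (intro norm_avg_le[OF A(1)]) (auto simp: dist_norm intro: less_imp_le)
      then show ?thesis by (simp add: avg_diff avg_shift dist_norm)
    qed
    have lower: "c - e \<le> avg A f p" for p
    proof (rule ccontr)
      assume p: "\<not> c - e \<le> avg A f p"
      define t' where "t' = ((L - 1) * t + (c - e / 2)) / L"
      have "avg S (avg A f) x \<le> t'" for x
      proof -
        obtain s where s: "s \<in> set S" "x - p + s \<in> U" using S(2) by blast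
        have "avg A f (x + s) \<le> c - e / 2"
          using osc[OF s(2), of p] p abs_ge_self[of "avg A f (x + s) - avg A f p"]
          by (simp add: dist_real_def)
        then have "(\<Sum>s\<leftarrow>S. avg A f (x + s)) \<le> (L - 1) * t + (c - e / 2)"
          unfolding L_def using A(2) s(1) by (intro sum_list_le_one_smaller) auto
        then have "(\<Sum>s\<leftarrow>S. avg A f (x + s)) / L \<le> t'"
          unfolding t'_def using L by (intro divide_right_mono) auto
        then show ?thesis
          by (simp add: avg_def[of S] L_def divide_inverse mult.commute)
      qed
      then have "t' \<in> T"
        unfolding T_def avg_list_plus[symmetric] using S(1) A(1)
        by (intro CollectI exI[of _ "list_plus S A"]) simp
      then have "c \<le> t'" by (rule c_le)
      then have "L * c \<le> L * t'" using L by (intro mult_left_mono) auto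
      also have "L * t' = (L - 1) * t + (c - e / 2)" using L by (simp add: t'_def)
      also have "(L - 1) * t \<le> (L - 1) * (c + d)"
        using L t(2) by (intro mult_left_mono) auto
      finally have "0 \<le> L * d - d - e / 2" by (simp add: algebra_simps)
      then show False using d e by simp
    qed
    have "norm (avg A f x - c) \<le> e" for x
      using lower[of x] A(2)[of x] t(2) d(2) by (simp add: abs_le_iff)
    then show "\<exists>A. A \<noteq> [] \<and> (\<forall>x. norm (avg A f x - c) \<le> e)"
      using A(1) by blast
  qed
  then show ?thesis ..
qed

lemma has_mean_exists_complex:
  fixes f :: "'a \<Rightarrow> complex"
  assumes "continuous_on UNIV f"
  shows "\<exists>c. has_mean f c"
proof -
  obtain a b where ab: "has_mean (\<lambda>x. Re (f x)) a" "has_mean (\<lambda>x. Im (f x)) b"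
    using has_mean_exists_real continuous_on_Re[OF assms] continuous_on_Im[OF assms] by blast
  have "has_mean (\<lambda>x. of_real (Re (f x)) + \<i> * of_real (Im (f x))) (of_real a + \<i> * of_real b)"
    by (intro has_mean_add has_mean_mult_left
        has_mean_bounded_linear[OF bounded_linear_of_real] ab)
  then show ?thesis
    by (auto simp flip: complex_eq)
qed

text \<open>By continuity \<open>f\<close> stays above \<open>f p / 2\<close> near \<open>p\<close>.
  Averages over a finite net meet this neighbourhood from every starting point, hence have a
  positive lower bound.\<close>

lemma has_mean_pos:
  fixes f :: "'a \<Rightarrow> real"
  assumes cont: "continuous_on UNIV f" and "\<And>x. 0 \<le> f x" "0 < f p" "has_mean f c"
  shows "0 < c"
proof -
  from uniform_continuity[OF cont half_gt_zero[OF \<open>0 < f p\<close>]] obtain U where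
    U: "open U" "0 \<in> U" "\<And>a x. a \<in> U \<Longrightarrow> dist (f (x + a)) (f x) < f p / 2"
    unfolding eventually_nhds by blast
  obtain S where S: "S \<noteq> []" "\<And>x. \<exists>s\<in>set S. x + s \<in> U"
    by (rule finite_net[OF U(1,2)]) blast
  have pos: "0 < f p / 2 / real (length S)" using assms S(1) by simp
  have "f p / 2 / real (length S) \<le> avg S f x" for x
  proof -
    obtain s where s: "s \<in> set S" "x - p + s \<in> U" using S(2) by blast
    have "f p / 2 \<le> f (x + s)"
      using U(3)[OF s(2), of p] abs_ge_minus_self[of "f (x + s) - f p"]
      by (simp add: dist_real_def add.commute)
    also have "\<dots> \<le> (\<Sum>s\<leftarrow>S. f (x + s))"
      using s(1) assms(2) by (intro member_le_sum_list) auto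
    finally show ?thesis
      using S(1) by (simp add: avg_def field_simps)
  qed
  with has_mean_mono[OF has_mean_const has_mean_avg[OF assms(4) S(1)]]
  have "f p / 2 / real (length S) \<le> c" by blast
  with pos show ?thesis by linarith
qed

end

lemma has_mean_norm_le_mean:
  assumes "has_mean f c" "has_mean g d" "\<And>x. norm (f x) \<le> g x"
  shows "norm c \<le> d"
proof (rule field_le_epsilon)
  fix e :: real assume "e > 0"
  then have "e / 2 > 0" by simp
  then obtain A where A: "A \<noteq> []" "\<And>x. norm (avg A f x - c) \<le> e / 2"
      "\<And>x. norm (avg A g x - d) \<le> e / 2"
    using has_mean_common[OF assms(1,2)] by blast
  have "norm (\<Sum>a\<leftarrow>A. f (0 + a)) \<le> (\<Sum>a\<leftarrow>A. g (0 + a))"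
  proof (induction A)
    case (Cons a A)
    then show ?case
      using norm_triangle_mono[OF assms(3)[of a] Cons] by simp
  qed simp
  then have "norm (avg A f 0) \<le> avg A g 0"
    by (simp add: avg_def mult_left_mono)
  moreover have "norm c \<le> norm (avg A f 0) + norm (avg A f 0 - c)"
    using norm_triangle_ineq4[of "avg A f 0" "avg A f 0 - c"] by simp
  ultimately show "norm c \<le> d + e"
    using A(2)[of 0] abs_ge_self[of "avg A g 0 - d"] A(3)[of 0] unfolding real_norm_def by linarith
qed

section \<open>Square means, autocorrelation and convolution\<close>

definition mean :: "('g::ab_group_add \<Rightarrow> 'b::real_normed_vector) \<Rightarrow> 'b"
  where "mean f = (THE c. has_mean f c)"

lemma mean_eqI: "has_mean f c \<Longrightarrow> mean f = c"
  unfolding mean_def using has_mean_unique by blast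

definition sq_mean :: "('g::ab_group_add \<Rightarrow> complex) \<Rightarrow> real"
  where "sq_mean f = mean (\<lambda>x. (cmod (f x))\<^sup>2)"

text \<open>The positive definite function attached to \<open>f\<close>: its Fourier coefficients
  are the squared moduli of those of \<open>f\<close>.\<close>

definition autocorr :: "('g::ab_group_add \<Rightarrow> complex) \<Rightarrow> 'g \<Rightarrow> complex"
  where "autocorr f x = mean (\<lambda>y. f (y + x) * cnj (f y))"

definition conv :: "('g::ab_group_add \<Rightarrow> complex) \<Rightarrow> ('g \<Rightarrow> complex) \<Rightarrow> 'g \<Rightarrow> complex"
  where "conv w f x = mean (\<lambda>z. w (x - z) * f z)"

context compact_group
begin

lemma has_mean_complex: "continuous_on UNIV (f :: 'a \<Rightarrow> complex) \<Longrightarrow> has_mean f (mean f)"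
  using has_mean_exists_complex mean_eqI by metis

lemma has_mean_real: "continuous_on UNIV (f :: 'a \<Rightarrow> real) \<Longrightarrow> has_mean f (mean f)"
  using has_mean_exists_real mean_eqI by metis

lemma has_mean_sq_mean:
  "continuous_on UNIV (f :: 'a \<Rightarrow> complex) \<Longrightarrow> has_mean (\<lambda>x. (cmod (f x))\<^sup>2) (sq_mean f)"
  unfolding sq_mean_def by (intro has_mean_real continuous_intros)

lemma continuous_translate:
  "continuous_on UNIV f \<Longrightarrow> continuous_on UNIV (\<lambda>x::'a. f (x + a))"
  by (rule continuous_on_compose2[of UNIV f]) (auto intro: continuous_intros)

lemma continuous_translate_diff:
  "continuous_on UNIV f \<Longrightarrow> continuous_on UNIV (\<lambda>x::'a. f (x - a))"
  by (rule continuous_on_compose2[of UNIV f]) (auto intro: continuous_intros)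

lemma continuous_reflect:
  "continuous_on UNIV f \<Longrightarrow> continuous_on UNIV (\<lambda>x::'a. f (a - x))"
  by (rule continuous_on_compose2[of UNIV f]) (auto intro: continuous_intros)

lemmas continuity = continuous_on_add continuous_on_diff continuous_on_mult continuous_on_const
  continuous_on_cnj continuous_translate continuous_translate_diff continuous_reflect

lemma continuous_onI_uniform:
  fixes f :: "'a \<Rightarrow> 'b::real_normed_vector"
  assumes "\<And>e. e > 0 \<Longrightarrow> \<forall>\<^sub>F a in nhds 0. \<forall>x. norm (f (x + a) - f x) \<le> e"
  shows "continuous_on UNIV f"
  unfolding continuous_on_def
proof (intro ballI tendstoI)
  fix x :: 'a and e :: real assume "e > 0"
  then have "\<forall>\<^sub>F a in nhds 0. \<forall>x. norm (f (x + a) - f x) \<le> e / 2"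
    using assms[of "e / 2"] by simp
  moreover have "((\<lambda>y. y - x) \<longlongrightarrow> x - x) (at x within UNIV)"
    by (intro tendsto_intros)
  ultimately have "\<forall>\<^sub>F y in at x within UNIV. \<forall>z. norm (f (z + (y - x)) - f z) \<le> e / 2"
    by (auto elim: eventually_compose_filterlim)
  then show "\<forall>\<^sub>F y in at x within UNIV. dist (f y) (f x) < e"
  proof eventually_elim
    case (elim y)
    then have "norm (f (x + (y - x)) - f x) \<le> e / 2" by blast
    then show ?case using \<open>e > 0\<close> by (simp add: dist_norm)
  qed
qed

lemma norm_mean_diff_le:
  fixes f g :: "'a \<Rightarrow> complex"
  assumes "continuous_on UNIV f" "continuous_on UNIV g" "\<And>x. norm (f x - g x) \<le> e"
  shows "norm (mean f - mean g) \<le> e"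
  by (rule has_mean_norm_le[OF has_mean_diff[OF has_mean_complex has_mean_complex]]) fact+

lemma sq_mean_nonneg: "continuous_on UNIV f \<Longrightarrow> 0 \<le> sq_mean (f :: 'a \<Rightarrow> complex)"
  by (rule has_mean_nonneg[OF has_mean_sq_mean]) auto

lemma sq_mean_le:
  assumes "continuous_on UNIV f" "\<And>x::'a. cmod (f x) \<le> B"
  shows "sq_mean f \<le> B\<^sup>2"
  by (rule has_mean_mono[OF has_mean_sq_mean[OF assms(1)] has_mean_const])
     (intro power_mono assms norm_ge_zero)

lemma sq_mean_translate:
  assumes "continuous_on UNIV f"
  shows "sq_mean (\<lambda>x::'a. f (x + a)) = sq_mean f"
  unfolding sq_mean_def[of "\<lambda>x. f (x + a)"]
  by (rule mean_eqI) (rule has_mean_shift[OF has_mean_sq_mean[OF assms]])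

lemma sq_mean_cmult:
  assumes "continuous_on UNIV f"
  shows "sq_mean (\<lambda>x::'a. c * f x) = (cmod c)\<^sup>2 * sq_mean f"
  unfolding sq_mean_def[of "\<lambda>x. c * f x"] norm_mult power_mult_distrib
  by (intro mean_eqI has_mean_mult_left has_mean_sq_mean assms)

lemma sq_mean_add_le:
  assumes "continuous_on UNIV f" "continuous_on UNIV g"
  shows "sq_mean (\<lambda>x::'a. f x + g x) \<le> 2 * sq_mean f + 2 * sq_mean g"
proof (rule has_mean_mono)
  show "has_mean (\<lambda>x. (cmod (f x + g x))\<^sup>2) (sq_mean (\<lambda>x. f x + g x))"
    by (intro has_mean_sq_mean continuity assms)
  show "has_mean (\<lambda>x. 2 * (cmod (f x))\<^sup>2 + 2 * (cmod (g x))\<^sup>2) (2 * sq_mean f + 2 * sq_mean g)"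
    by (intro has_mean_add has_mean_mult_left has_mean_sq_mean assms)
  fix x
  have "(cmod (f x + g x))\<^sup>2 + (cmod (f x - g x))\<^sup>2 = 2 * (cmod (f x))\<^sup>2 + 2 * (cmod (g x))\<^sup>2"
    unfolding cmod_power2 by (simp add: power2_eq_square algebra_simps)
  then show "(cmod (f x + g x))\<^sup>2 \<le> 2 * (cmod (f x))\<^sup>2 + 2 * (cmod (g x))\<^sup>2"
    using zero_le_power2[of "cmod (f x - g x)"] by linarith
qed

text \<open>The weights are chosen to eliminate the inner product of \<open>u\<close> and
  \<open>v\<close>. For \<open>\<bar>r\<bar> \<le> 1\<close> the first two are nonnegative, so upper
  bounds for \<open>u + v\<close> and \<open>u - v\<close> control the distance from
  \<open>v\<close> to \<open>r u\<close>.\<close>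

lemma sq_mean_diff_scale:
  assumes "continuous_on UNIV u" "continuous_on UNIV v"
  shows "sq_mean (\<lambda>x::'a. v x - of_real r * u x)
    = (1 - r) / 2 * sq_mean (\<lambda>x. u x + v x) + (1 + r) / 2 * sq_mean (\<lambda>x. u x - v x)
      - (1 - r\<^sup>2) * sq_mean u"
proof -
  have eq: "(cmod (v x - of_real r * u x))\<^sup>2
    = (1 - r) / 2 * (cmod (u x + v x))\<^sup>2 + (1 + r) / 2 * (cmod (u x - v x))\<^sup>2
      - (1 - r\<^sup>2) * (cmod (u x))\<^sup>2" for x
    by (simp add: cmod_power2 field_simps) (simp add: power2_eq_square algebra_simps)
  show ?thesis
    unfolding sq_mean_def[of "\<lambda>x. v x - of_real r * u x"] eq
    by (intro mean_eqI has_mean_diff has_mean_add has_mean_mult_left has_mean_sq_mean continuity assms)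
qed

lemma has_mean_autocorr:
  assumes "continuous_on UNIV f"
  shows "has_mean (\<lambda>y::'a. f (y + x) * cnj (f y)) (autocorr f x)"
  unfolding autocorr_def by (intro has_mean_complex continuity assms)

lemma autocorr_0:
  assumes "continuous_on UNIV f"
  shows "autocorr f (0::'a) = of_real (sq_mean f)"
  unfolding autocorr_def add_0_right complex_norm_square[symmetric]
  by (intro mean_eqI has_mean_bounded_linear[OF bounded_linear_of_real] has_mean_sq_mean assms)

lemma autocorr_minus:
  assumes "continuous_on UNIV f"
  shows "autocorr f (- x::'a) = cnj (autocorr f x)"
proof -
  have "has_mean (\<lambda>y. cnj (f (y + - x + x) * cnj (f (y + - x)))) (cnj (autocorr f x))"
    by (rule has_mean_bounded_linear[OF bounded_linear_cnj
          has_mean_shift[OF has_mean_autocorr[OF assms]]])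
  then have "has_mean (\<lambda>y. f (y + - x) * cnj (f y)) (cnj (autocorr f x))"
    by (simp add: mult.commute)
  then show ?thesis
    unfolding autocorr_def[of f "- x"] by (rule mean_eqI)
qed

text \<open>Translates have equal square means, so the inequality of arithmetic and geometric means
  does the work of Cauchy-Schwarz.\<close>

lemma norm_autocorr_le:
  assumes "continuous_on UNIV f"
  shows "cmod (autocorr f (x::'a)) \<le> sq_mean f"
proof -
  have "cmod (autocorr f x) \<le> (sq_mean f + sq_mean f) / 2"
  proof (rule has_mean_norm_le_mean[OF has_mean_autocorr[OF assms]])
    show "has_mean (\<lambda>y. ((cmod (f (y + x)))\<^sup>2 + (cmod (f y))\<^sup>2) / 2) ((sq_mean f + sq_mean f) / 2)"
      unfolding divide_inverse[of _ 2]
      by (intro has_mean_bounded_linear[OF bounded_linear_mult_left] has_mean_add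
          has_mean_shift[OF has_mean_sq_mean[OF assms]] has_mean_sq_mean[OF assms])
    show "norm (f (y + x) * cnj (f y)) \<le> ((cmod (f (y + x)))\<^sup>2 + (cmod (f y))\<^sup>2) / 2" for y
      using sum_squares_bound[of "cmod (f (y + x))" "cmod (f y)"] by (simp add: norm_mult)
  qed
  then show ?thesis by simp
qed

lemma continuous_autocorr:
  assumes "continuous_on UNIV (f :: 'a \<Rightarrow> complex)"
  shows "continuous_on UNIV (autocorr f)"
proof (rule continuous_onI_uniform)
  fix e :: real assume "e > 0"
  obtain B where B: "B > 0" "\<forall>x. cmod (f x) \<le> B"
    using bounded_continuous[OF assms] by blast
  have "e / B > 0" using \<open>e > 0\<close> B(1) by simp
  from uniform_continuity[OF assms this]
  show "\<forall>\<^sub>F a in nhds 0. \<forall>x. cmod (autocorr f (x + a) - autocorr f x) \<le> e"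
  proof eventually_elim
    case (elim a)
    show ?case unfolding autocorr_def
    proof (intro allI norm_mean_diff_le)
      fix x y
      have "cmod (f (y + (x + a)) * cnj (f y) - f (y + x) * cnj (f y))
          = dist (f (y + x + a)) (f (y + x)) * cmod (f y)"
        unfolding left_diff_distrib[symmetric] norm_mult complex_mod_cnj dist_norm add.assoc ..
      also have "\<dots> \<le> e / B * B"
        using elim B \<open>e > 0\<close> by (intro mult_mono) (auto intro: less_imp_le)
      finally show "cmod (f (y + (x + a)) * cnj (f y) - f (y + x) * cnj (f y)) \<le> e"
        using B by simp
    qed (intro continuity assms)+
  qed
qed

lemma autocorr_cmult:
  assumes "continuous_on UNIV f"
  shows "autocorr (\<lambda>x. c * f x) (x::'a) = of_real ((cmod c)\<^sup>2) * autocorr f x"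
proof -
  have "(c * f (y + x)) * cnj (c * f y) = of_real ((cmod c)\<^sup>2) * (f (y + x) * cnj (f y))" for y
    by (simp add: complex_norm_square algebra_simps del: of_real_power)
  then show ?thesis
    unfolding autocorr_def[of "\<lambda>x. c * f x"]
    by (simp only:) (intro mean_eqI has_mean_mult_left has_mean_autocorr assms)
qed

text \<open>In terms of Fourier coefficients, adding the translate of \<open>f\<close> by \<open>a\<close> multiplies the
  coefficient of \<open>autocorr f\<close> at a character \<open>\<gamma>\<close> by \<open>\<bar>1 + c \<gamma> a\<bar>\<^sup>2 / 2 = 1 + Re (c \<gamma> a)\<close>.\<close>

lemma autocorr_perturb:
  assumes "continuous_on UNIV f" "cmod c = 1"
  shows "autocorr (\<lambda>x. of_real (1 / sqrt 2) * (f x + c * f (x + a))) (x::'a)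
    = autocorr f x + (c * autocorr f (x + a) + cnj c * autocorr f (x - a)) / 2"
proof -
  have cc: "c * cnj c = 1" using assms(2) complex_norm_square[of c] by simp
  have 1: "(of_real (1 / sqrt 2) * (p + c * q)) * cnj (of_real (1 / sqrt 2) * (p' + c * q'))
      = (1 / 2) * ((p * cnj p' + q * cnj q') + (c * (q * cnj p') + cnj c * (p * cnj q')))"
    for p q p' q' :: complex
  proof -
    have "complex_of_real (1 / sqrt 2) * cnj (complex_of_real (1 / sqrt 2)) = 1 / 2"
      by (simp add: field_simps flip: of_real_mult)
    then have "(of_real (1 / sqrt 2) * (p + c * q)) * cnj (of_real (1 / sqrt 2) * (p' + c * q'))
      = (1 / 2) * ((p + c * q) * cnj (p' + c * q'))"
      by (metis (no_types, lifting) complex_cnj_mult mult.assoc mult.left_commute)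
    also have "(p + c * q) * cnj (p' + c * q')
      = p * cnj p' + (c * cnj c) * (q * cnj q') + (c * (q * cnj p') + cnj c * (p * cnj q'))"
      by (simp add: algebra_simps)
    finally show ?thesis using cc by simp
  qed
  have "has_mean (\<lambda>y. f (y + a + x) * cnj (f (y + a))) (autocorr f x)"
    by (rule has_mean_shift[OF has_mean_autocorr[OF assms(1)]])
  moreover have "has_mean (\<lambda>y. f (y + a + (x - a)) * cnj (f (y + a))) (autocorr f (x - a))"
    by (rule has_mean_shift[OF has_mean_autocorr[OF assms(1)]])
  ultimately have "has_mean (\<lambda>y. (1 / 2) * ((f (y + x) * cnj (f y) + f (y + x + a) * cnj (f (y + a)))
      + (c * (f (y + (x + a)) * cnj (f y)) + cnj c * (f (y + x) * cnj (f (y + a))))))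
    ((1 / 2) * ((autocorr f x + autocorr f x) + (c * autocorr f (x + a) + cnj c * autocorr f (x - a))))"
    by (intro has_mean_mult_left has_mean_add has_mean_autocorr[OF assms(1)])
       (simp_all add: algebra_simps)
  then show ?thesis
    unfolding autocorr_def[of "\<lambda>x. of_real (1 / sqrt 2) * (f x + c * f (x + a))"] 1
    by (subst mean_eqI[of _ "(1 / 2) * ((autocorr f x + autocorr f x) + (c * autocorr f (x + a) + cnj c * autocorr f (x - a)))"])
       (simp_all add: algebra_simps)
qed

lemma has_mean_conv:
  assumes "continuous_on UNIV w" "continuous_on UNIV f"
  shows "has_mean (\<lambda>z::'a. w (x - z) * f z) (conv w f x)"
  unfolding conv_def by (intro has_mean_complex continuity assms)

lemma conv_add:
  assumes "continuous_on UNIV w" "continuous_on UNIV f" "continuous_on UNIV g"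
  shows "conv w (\<lambda>z. f z + g z) (x::'a) = conv w f x + conv w g x"
  unfolding conv_def[of w "\<lambda>z. f z + g z"] distrib_left
  by (intro mean_eqI has_mean_add has_mean_conv assms)

lemma conv_cmult:
  assumes "continuous_on UNIV w" "continuous_on UNIV f"
  shows "conv w (\<lambda>z. c * f z) (x::'a) = c * conv w f x"
  unfolding conv_def[of w "\<lambda>z. c * f z"] mult.left_commute[of _ c]
  by (intro mean_eqI has_mean_mult_left has_mean_conv assms)

lemma conv_translate:
  assumes "continuous_on UNIV w" "continuous_on UNIV f"
  shows "conv w (\<lambda>z. f (z + a)) (x::'a) = conv w f (x + a)"
proof -
  have "has_mean (\<lambda>z. w (x + a - (z + a)) * f (z + a)) (conv w f (x + a))"
    by (rule has_mean_shift[OF has_mean_conv[OF assms]])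
  then show ?thesis
    unfolding conv_def[of w "\<lambda>z. f (z + a)"] by (intro mean_eqI) simp
qed

text \<open>The estimate depends on \<open>f\<close> only through the bound \<open>B\<close>; this
  uniformity later makes the limit character continuous.\<close>

lemma norm_conv_diff_le:
  assumes "continuous_on UNIV w" "continuous_on UNIV f"
    and "\<And>z. cmod (f z) \<le> B" "\<And>z. cmod (w (z + a) - w z) \<le> e"
  shows "cmod (conv w f (x + a) - conv w f (x::'a)) \<le> e * B"
  unfolding conv_def
proof (rule norm_mean_diff_le)
  fix z
  have "cmod (w (x + a - z) * f z - w (x - z) * f z) = cmod (w (x - z + a) - w (x - z)) * cmod (f z)"
    unfolding left_diff_distrib[symmetric] norm_mult by (simp add: algebra_simps)
  also have "\<dots> \<le> e * B"
    using assms(3,4) norm_ge_zero order.trans[OF norm_ge_zero assms(4)] by (intro mult_mono) blast+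
  finally show "cmod (w (x + a - z) * f z - w (x - z) * f z) \<le> e * B" .
qed (intro continuity assms)+

lemma norm_conv_le:
  assumes "continuous_on UNIV w" "continuous_on UNIV f"
    and "\<And>z. cmod (f z) \<le> B" "\<And>z. cmod (w z) \<le> W"
  shows "cmod (conv w f (x::'a)) \<le> W * B"
proof (rule has_mean_norm_le[OF has_mean_conv[OF assms(1,2)]])
  show "cmod (w (x - z) * f z) \<le> W * B" for z
    unfolding norm_mult using assms(3,4) order.trans[OF norm_ge_zero assms(4)]
    by (intro mult_mono) auto
qed

lemma continuous_conv:
  assumes "continuous_on UNIV w" "continuous_on UNIV (f :: 'a \<Rightarrow> complex)"
  shows "continuous_on UNIV (conv w f)"
proof (rule continuous_onI_uniform)
  fix e :: real assume "e > 0"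
  obtain B where B: "B > 0" "\<forall>x. cmod (f x) \<le> B"
    using bounded_continuous[OF assms(2)] by blast
  have "e / B > 0" using \<open>e > 0\<close> B(1) by simp
  from uniform_continuity[OF assms(1) this]
  show "\<forall>\<^sub>F a in nhds 0. \<forall>x. cmod (conv w f (x + a) - conv w f x) \<le> e"
  proof eventually_elim
    case (elim a)
    have "cmod (conv w f (x + a) - conv w f x) \<le> e / B * B" for x
      using elim B(2) by (intro norm_conv_diff_le assms) (auto simp: dist_norm intro: less_imp_le)
    then show ?case using B(1) by simp
  qed
qed

end

text \<open>Tychonoff's theorem for a product of closed unit discs. Over an arbitrary index set this
  yields a cluster point, approached on finite sets at arbitrarily large indices, rather than a
  convergent subsequence.\<close>

lemma pointwise_cluster_point:
  fixes \<phi> :: "nat \<Rightarrow> 'b \<Rightarrow> complex"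
  assumes "\<And>n x. cmod (\<phi> n x) \<le> 1"
  obtains \<gamma> where "\<And>Y e m. finite Y \<Longrightarrow> e > 0 \<Longrightarrow> \<exists>n\<ge>m. \<forall>y\<in>Y. dist (\<phi> n y) (\<gamma> y) < e"
proof -
  have "compactin (product_topology (\<lambda>_. euclidean) UNIV) (PiE UNIV (\<lambda>_::'b. cball (0::complex) 1))"
    by (simp add: compactin_PiE)
  then have "compact (PiE UNIV (\<lambda>_::'b. cball (0::complex) 1))"
    by (simp add: euclidean_product_topology)
  moreover have "filtermap \<phi> sequentially \<noteq> bot"
    by (simp add: filtermap_bot_iff)
  moreover have "eventually (\<lambda>g. g \<in> PiE UNIV (\<lambda>_::'b. cball (0::complex) 1)) (filtermap \<phi> sequentially)"
    using assms by (auto simp: eventually_filtermap PiE_UNIV_domain)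
  ultimately obtain \<gamma> where \<gamma>: "inf (nhds \<gamma>) (filtermap \<phi> sequentially) \<noteq> bot"
    unfolding compact_filter by blast
  show ?thesis
  proof (rule that)
    fix Y :: "'b set" and e :: real and m :: nat
    assume "finite Y" "e > 0"
    have "\<forall>\<^sub>F g in nhds \<gamma>. dist (g y) (\<gamma> y) < e" for y
    proof -
      have "continuous_on UNIV (\<lambda>g::'b \<Rightarrow> complex. g y)"
        by (rule continuous_on_product_coordinates)
      then have "((\<lambda>g. g y) \<longlongrightarrow> \<gamma> y) (nhds \<gamma>)"
        by (auto simp: continuous_on_def tendsto_nhds_iff)
      then show ?thesis using \<open>e > 0\<close> by (rule tendstoD)
    qed
    then have "\<forall>\<^sub>F g in nhds \<gamma>. \<forall>y\<in>Y. dist (g y) (\<gamma> y) < e"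
      using \<open>finite Y\<close> by (intro eventually_ball_finite) auto
    then have "\<forall>\<^sub>F g in inf (nhds \<gamma>) (filtermap \<phi> sequentially). \<forall>y\<in>Y. dist (g y) (\<gamma> y) < e"
      by (rule filter_leD[OF inf_le1])
    moreover have "\<forall>\<^sub>F g in filtermap \<phi> sequentially. \<exists>n\<ge>m. g = \<phi> n"
      unfolding eventually_filtermap using eventually_ge_at_top[of m] by eventually_elim auto
    then have "\<forall>\<^sub>F g in inf (nhds \<gamma>) (filtermap \<phi> sequentially). \<exists>n\<ge>m. g = \<phi> n"
      by (rule filter_leD[OF inf_le2])
    ultimately have "\<forall>\<^sub>F g in inf (nhds \<gamma>) (filtermap \<phi> sequentially).
        \<exists>n\<ge>m. \<forall>y\<in>Y. dist (\<phi> n y) (\<gamma> y) < e"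
      by eventually_elim blast
    then show "\<exists>n\<ge>m. \<forall>y\<in>Y. dist (\<phi> n y) (\<gamma> y) < e"
      using eventually_happens \<gamma> by blast
  qed
qed

section \<open>A variational problem for the kernel \<open>w\<close> and the translation by
  \<open>a\<^sub>0\<close>\<close>

locale variational = compact_group type for type :: "'a::{topological_ab_group_add, t2_space} itself" +
  fixes w :: "'a \<Rightarrow> complex" and W :: real and a\<^sub>0 :: 'a
  assumes cont_w: "continuous_on UNIV w" and w_le: "\<And>x. cmod (w x) \<le> W"
begin

definition C :: "('a \<Rightarrow> complex) \<Rightarrow> 'a \<Rightarrow> complex"
  where "C f = conv w (autocorr f)"

definition u :: "('a \<Rightarrow> complex) \<Rightarrow> 'a \<Rightarrow> complex"
  where "u f x = C f x - C f (x + a\<^sub>0)"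

text \<open>In Fourier terms \<open>Q f\<close> is a sum of terms \<open>k p\<^sup>2\<close> over
  all characters, where \<open>p\<close> is the squared modulus of the coefficient of
  \<open>f\<close> and \<open>k \<ge> 0\<close> vanishes at characters trivial at
  \<open>a\<^sub>0\<close>. For admissible \<open>f\<close> the \<open>p\<close> sum to one, so this
  convex expression is largest when a single character carries all the weight.\<close>

definition Q :: "('a \<Rightarrow> complex) \<Rightarrow> real"
  where "Q f = sq_mean (u f)"

definition admissible :: "('a \<Rightarrow> complex) \<Rightarrow> bool"
  where "admissible f \<longleftrightarrow> continuous_on UNIV f \<and> sq_mean f = 1"

definition s :: real
  where "s = Sup (Q ` Collect admissible)"

lemma continuous_C: "continuous_on UNIV f \<Longrightarrow> continuous_on UNIV (C f)"
  unfolding C_def by (intro continuous_conv cont_w continuous_autocorr)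

lemma continuous_u: "continuous_on UNIV f \<Longrightarrow> continuous_on UNIV (u f)"
  unfolding u_def by (intro continuity continuous_C)

lemma norm_C_le: "continuous_on UNIV f \<Longrightarrow> cmod (C f x) \<le> W * sq_mean f"
  unfolding C_def by (intro norm_conv_le cont_w continuous_autocorr norm_autocorr_le w_le)

lemma norm_u_le: "continuous_on UNIV f \<Longrightarrow> cmod (u f x) \<le> 2 * W * sq_mean f"
  using norm_triangle_ineq4[of "C f x" "C f (x + a\<^sub>0)"] norm_C_le[of f x] norm_C_le[of f "x + a\<^sub>0"]
  unfolding u_def by simp

lemma norm_u_diff_le:
  assumes "continuous_on UNIV f" "\<And>z. cmod (w (z + a) - w z) \<le> e"
  shows "cmod (u f (x + a) - u f x) \<le> 2 * e * sq_mean f"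
proof -
  have "cmod (C f (x + a) - C f x) \<le> e * sq_mean f" for x
    unfolding C_def
    by (intro norm_conv_diff_le cont_w continuous_autocorr norm_autocorr_le assms)
  from this[of x] this[of "x + a\<^sub>0"] show ?thesis
    using norm_triangle_ineq4[of "C f (x + a) - C f x" "C f (x + a\<^sub>0 + a) - C f (x + a\<^sub>0)"]
    unfolding u_def by (simp add: algebra_simps)
qed

lemma u_cmult:
  assumes "continuous_on UNIV f"
  shows "u (\<lambda>x. c * f x) x = of_real ((cmod c)\<^sup>2) * u f x"
proof -
  have "autocorr (\<lambda>x. c * f x) = (\<lambda>x. of_real ((cmod c)\<^sup>2) * autocorr f x)"
    by (intro ext autocorr_cmult assms)
  then show ?thesis
    by (simp add: u_def C_def conv_cmult cont_w continuous_autocorr assms right_diff_distrib)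
qed

lemma u_perturb:
  assumes "continuous_on UNIV f" "cmod c = 1"
  shows "u (\<lambda>x. of_real (1 / sqrt 2) * (f x + c * f (x + a))) x
    = u f x + (c * u f (x + a) + cnj c * u f (x - a)) / 2"
proof -
  note cont = continuous_autocorr[OF assms(1)]
  have "autocorr (\<lambda>x. of_real (1 / sqrt 2) * (f x + c * f (x + a)))
      = (\<lambda>x. autocorr f x + (c / 2 * autocorr f (x + a) + cnj c / 2 * autocorr f (x + - a)))"
    by (rule ext, subst autocorr_perturb[OF assms]) (simp add: add_divide_distrib)
  moreover have "conv w (\<lambda>x. autocorr f x + (c / 2 * autocorr f (x + a) + cnj c / 2 * autocorr f (x + - a))) x
      = conv w (autocorr f) x + (c / 2 * conv w (autocorr f) (x + a)
          + cnj c / 2 * conv w (autocorr f) (x + - a))" for x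
  proof -
    have cont': "continuous_on UNIV (\<lambda>x. d * autocorr f (x + b))" for d b
      by (intro continuous_on_mult continuous_on_const continuous_translate cont)
    have translate: "conv w (\<lambda>x. d * autocorr f (x + b)) x = d * conv w (autocorr f) (x + b)" for d b
      by (subst conv_cmult[OF cont_w continuous_translate[OF cont]])
         (subst conv_translate[OF cont_w cont], rule refl)
    show ?thesis
      by (subst conv_add[OF cont_w cont continuous_on_add[OF cont' cont']],
          subst conv_add[OF cont_w cont' cont'], subst (1 2) translate, rule refl)
  qed
  ultimately have "C (\<lambda>x. of_real (1 / sqrt 2) * (f x + c * f (x + a))) x
      = C f x + (c / 2 * C f (x + a) + cnj c / 2 * C f (x + - a))" for x
    unfolding C_def by simp
  then show ?thesis
    unfolding u_def by (simp add: field_simps)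
qed

lemma bdd_above_Q: "bdd_above (Q ` Collect admissible)"
proof (rule bdd_aboveI2)
  fix f assume "f \<in> Collect admissible"
  then have f: "continuous_on UNIV f" "sq_mean f = 1" by (auto simp: admissible_def)
  show "Q f \<le> (2 * W)\<^sup>2"
    unfolding Q_def using norm_u_le[OF f(1)] f(2) by (intro sq_mean_le continuous_u f) simp
qed

lemma Q_le_s: "admissible f \<Longrightarrow> Q f \<le> s"
  unfolding s_def by (intro cSUP_upper bdd_above_Q) auto

text \<open>\<open>Q\<close> is homogeneous of degree four, so normalizing \<open>f\<close> reduces
  the claim to admissible functions. If \<open>sq_mean f = 0\<close>, the bound
  \<open>norm_u_le\<close> makes \<open>u f\<close> vanish.\<close>

lemma Q_le:
  assumes "continuous_on UNIV f"
  shows "Q f \<le> s * (sq_mean f)\<^sup>2"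
proof (cases "sq_mean f = 0")
  case True
  then have "Q f \<le> 0\<^sup>2"
    unfolding Q_def using norm_u_le[OF assms] by (intro sq_mean_le continuous_u assms) simp
  then show ?thesis using True by simp
next
  case False
  define t where "t = sq_mean f"
  have t: "t > 0" using False sq_mean_nonneg[OF assms] by (simp add: t_def)
  define c where "c = complex_of_real (1 / sqrt t)"
  have c: "(cmod c)\<^sup>2 = 1 / t" using t by (simp add: c_def norm_divide power_divide)
  have "admissible (\<lambda>x. c * f x)"
    unfolding admissible_def sq_mean_cmult[OF assms] c
    using t by (auto intro!: continuity assms simp: t_def)
  then have "Q (\<lambda>x. c * f x) \<le> s" by (rule Q_le_s)
  moreover have "u (\<lambda>x. c * f x) = (\<lambda>x. of_real (1 / t) * u f x)"
    by (intro ext) (simp add: u_cmult[OF assms] c)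
  then have "Q (\<lambda>x. c * f x) = (1 / t)\<^sup>2 * Q f"
    unfolding Q_def by (simp only: sq_mean_cmult[OF continuous_u[OF assms]] norm_of_real power2_abs)
  ultimately show ?thesis
    using t unfolding t_def[symmetric] by (simp add: field_simps)
qed

lemma sq_mean_perturb:
  assumes "admissible f" "cmod c = 1"
  shows "sq_mean (\<lambda>x. of_real (1 / sqrt 2) * (f x + c * f (x + a))) = 1 + Re (c * autocorr f a)"
proof -
  have f: "continuous_on UNIV f" "sq_mean f = 1" using assms by (auto simp: admissible_def)
  have "complex_of_real (sq_mean (\<lambda>x. of_real (1 / sqrt 2) * (f x + c * f (x + a))))
      = autocorr (\<lambda>x. of_real (1 / sqrt 2) * (f x + c * f (x + a))) 0"
    by (intro autocorr_0[symmetric] continuity f)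
  also have "\<dots> = 1 + (c * autocorr f a + cnj (c * autocorr f a)) / 2"
    by (simp add: autocorr_perturb[OF f(1) assms(2)] autocorr_0 autocorr_minus f del: of_real_divide)
  also have "\<dots> = of_real (1 + Re (c * autocorr f a))"
    by (simp add: complex_add_cnj del: complex_cnj_mult)
  finally show ?thesis by (simp only: of_real_eq_iff)
qed

text \<open>\<open>Q\<close> is at most \<open>s (1 \<plusminus> r)\<^sup>2\<close> at the two perturbations of \<open>f\<close>, whose images under \<open>u\<close> are
  \<open>u f \<plusminus> v\<close>; so \<open>v\<close> is close to \<open>r u f\<close> when \<open>f\<close> is almost optimal.\<close>

lemma almost_eigen_real:
  assumes "admissible f" "cmod c = 1"
  shows "sq_mean (\<lambda>x. (c * u f (x + a) + cnj c * u f (x - a)) / 2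
      - of_real (Re (c * autocorr f a)) * u f x) \<le> s - Q f"
proof -
  have f: "continuous_on UNIV f" "sq_mean f = 1" using assms by (auto simp: admissible_def)
  define r where "r = Re (c * autocorr f a)"
  define v where "v x = (c * u f (x + a) + cnj c * u f (x - a)) / 2" for x
  have cont: "continuous_on UNIV (u f)" "continuous_on UNIV v"
    unfolding v_def divide_inverse by (intro continuity continuous_u f)+
  have "\<bar>r\<bar> \<le> cmod (c * autocorr f a)" unfolding r_def by (rule abs_Re_le_cmod)
  also have "\<dots> \<le> 1" using norm_autocorr_le[OF f(1), of a] f(2) assms(2) by (simp add: norm_mult)
  finally have r: "-1 \<le> r" "r \<le> 1" by auto
  have perturb: "sq_mean (\<lambda>x. u f x + (d * u f (x + a) + cnj d * u f (x - a)) / 2)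
      \<le> s * (1 + Re (d * autocorr f a))\<^sup>2" if d: "cmod d = 1" for d
  proof -
    have "Q (\<lambda>x. of_real (1 / sqrt 2) * (f x + d * f (x + a))) \<le> s * (1 + Re (d * autocorr f a))\<^sup>2"
      unfolding sq_mean_perturb[OF assms(1) d, symmetric] by (intro Q_le continuity f)
    then show ?thesis
      unfolding Q_def u_perturb[OF f(1) d] .
  qed
  have "sq_mean (\<lambda>x. u f x + v x) \<le> s * (1 + r)\<^sup>2"
    unfolding v_def r_def by (rule perturb[OF assms(2)])
  moreover have "sq_mean (\<lambda>x. u f x - v x) \<le> s * (1 - r)\<^sup>2"
    using perturb[of "- c"] assms(2) by (simp add: v_def r_def field_simps)
  ultimately have "sq_mean (\<lambda>x. v x - of_real r * u f x)
      \<le> (1 - r) / 2 * (s * (1 + r)\<^sup>2) + (1 + r) / 2 * (s * (1 - r)\<^sup>2) - (1 - r\<^sup>2) * Q f"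
    unfolding sq_mean_diff_scale[OF cont] Q_def
    using r by (intro diff_mono add_mono mult_left_mono order.refl) auto
  also have "\<dots> = (1 - r\<^sup>2) * (s - Q f)"
    by (simp add: field_simps power2_eq_square)
  also have "\<dots> \<le> 1 * (s - Q f)"
    using Q_le_s[OF assms(1)] by (intro mult_right_mono) auto
  finally show ?thesis by (simp add: v_def r_def)
qed

text \<open>In \<open>almost_eigen_real\<close>, \<open>c = 1\<close> treats the part symmetric
  under exchanging \<open>a\<close> and \<open>- a\<close>, and \<open>c = \<i>\<close> the
  antisymmetric part; \<open>p 1 - \<i> * p \<i>\<close> recombines them into translation by
  \<open>a\<close> alone.\<close>

lemma almost_eigen:
  assumes "admissible f"
  shows "sq_mean (\<lambda>x. u f (x + a) - autocorr f a * u f x) \<le> 4 * (s - Q f)"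
proof -
  have f: "continuous_on UNIV f" "sq_mean f = 1" using assms by (auto simp: admissible_def)
  define p where "p c x = (c * u f (x + a) + cnj c * u f (x - a)) / 2
      - of_real (Re (c * autocorr f a)) * u f x" for c x
  have cont: "continuous_on UNIV (p c)" for c
    unfolding p_def divide_inverse by (intro continuity continuous_u f)
  have p: "sq_mean (p c) \<le> s - Q f" if "cmod c = 1" for c
    unfolding p_def by (rule almost_eigen_real[OF assms that])
  have "u f (x + a) - autocorr f a * u f x = p 1 x + (- \<i>) * p \<i> x" for x
  proof -
    have "of_real (Re (autocorr f a)) * u f x + \<i> * of_real (Im (autocorr f a)) * u f x
        = autocorr f a * u f x"
      unfolding distrib_right[symmetric] complex_eq[symmetric] ..
    from this[symmetric] show ?thesis unfolding p_def by (simp only:) (simp add: field_simps)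
  qed
  then have "sq_mean (\<lambda>x. u f (x + a) - autocorr f a * u f x) = sq_mean (\<lambda>x. p 1 x + (- \<i>) * p \<i> x)"
    by simp
  also have "\<dots> \<le> 2 * sq_mean (p 1) + 2 * sq_mean (\<lambda>x. (- \<i>) * p \<i> x)"
    by (intro sq_mean_add_le continuity cont)
  also have "sq_mean (\<lambda>x. (- \<i>) * p \<i> x) = sq_mean (p \<i>)"
    by (subst sq_mean_cmult[OF cont]) simp
  finally show ?thesis using p[of 1] p[of \<i>] by simp
qed

text \<open>Up to the eigenfunction error, \<open>(autocorr f a - 1) * u f\<close> is the increment
  of \<open>u f\<close> under translation by \<open>a\<close>. This transfers the continuity of
  \<open>u f\<close>, which is uniform in admissible \<open>f\<close>, to \<open>autocorr f\<close>
  at zero.\<close>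

lemma autocorr_diff_one_le:
  assumes "admissible f"
  shows "(cmod (autocorr f a - 1))\<^sup>2 * Q f
    \<le> 8 * (s - Q f) + 2 * sq_mean (\<lambda>x. u f (x + a) - u f x)"
proof -
  have f: "continuous_on UNIV f" "sq_mean f = 1" using assms by (auto simp: admissible_def)
  have "(cmod (autocorr f a - 1))\<^sup>2 * Q f = sq_mean (\<lambda>x. (-1) * (u f (x + a) - autocorr f a * u f x)
      + (u f (x + a) - u f x))"
    unfolding Q_def sq_mean_cmult[OF continuous_u[OF f(1)], symmetric] by (simp add: algebra_simps)
  also have "\<dots> \<le> 2 * sq_mean (\<lambda>x. (-1) * (u f (x + a) - autocorr f a * u f x))
      + 2 * sq_mean (\<lambda>x. u f (x + a) - u f x)"
    by (intro sq_mean_add_le continuity continuous_u f)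
  also have "sq_mean (\<lambda>x. (-1) * (u f (x + a) - autocorr f a * u f x))
      = sq_mean (\<lambda>x. u f (x + a) - autocorr f a * u f x)"
    by (subst sq_mean_cmult) (auto intro!: continuity continuous_u f)
  finally show ?thesis using almost_eigen[OF assms, of a] by simp
qed

text \<open>The reverse estimate: an eigenvalue near one makes \<open>u f\<close> almost invariant.
  It is applied at \<open>- a\<^sub>0\<close> to rule out a character trivial at
  \<open>a\<^sub>0\<close>.\<close>

lemma translation_diff_le:
  assumes "admissible f"
  shows "sq_mean (\<lambda>x. u f (x + a) - u f x)
    \<le> 8 * (s - Q f) + 2 * ((cmod (autocorr f a - 1))\<^sup>2 * Q f)"
proof -
  have f: "continuous_on UNIV f" "sq_mean f = 1" using assms by (auto simp: admissible_def)
  have "sq_mean (\<lambda>x. u f (x + a) - u f x) = sq_mean (\<lambda>x. (u f (x + a) - autocorr f a * u f x)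
      + (autocorr f a - 1) * u f x)"
    by (simp add: algebra_simps)
  also have "\<dots> \<le> 2 * sq_mean (\<lambda>x. u f (x + a) - autocorr f a * u f x)
      + 2 * sq_mean (\<lambda>x. (autocorr f a - 1) * u f x)"
    by (intro sq_mean_add_le continuity continuous_u f)
  also have "sq_mean (\<lambda>x. (autocorr f a - 1) * u f x) = (cmod (autocorr f a - 1))\<^sup>2 * Q f"
    unfolding Q_def by (intro sq_mean_cmult continuous_u f)
  finally show ?thesis using almost_eigen[OF assms, of a] by simp
qed

text \<open>Compare translation by \<open>a + b\<close> in one step with translation by
  \<open>b\<close> and by \<open>a\<close> in succession. The constant is
  \<open>2 * 4 + 2 * (2 * 4 + 2 * 4)\<close>, from two applications of
  \<open>sq_mean_add_le\<close>.\<close>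

lemma almost_multiplicative:
  assumes "admissible f"
  shows "(cmod (autocorr f (a + b) - autocorr f a * autocorr f b))\<^sup>2 * Q f \<le> 40 * (s - Q f)"
proof -
  have f: "continuous_on UNIV f" "sq_mean f = 1" using assms by (auto simp: admissible_def)
  define d where "d a x = u f (x + a) - autocorr f a * u f x" for a x
  have cont: "continuous_on UNIV (d a)" for a
    unfolding d_def by (intro continuity continuous_u f)
  have d: "sq_mean (d a) \<le> 4 * (s - Q f)" for a
    unfolding d_def by (rule almost_eigen[OF assms])
  have "(cmod (autocorr f (a + b) - autocorr f a * autocorr f b))\<^sup>2 * Q f
      = sq_mean (\<lambda>x. (-1) * d (a + b) x + (d a (x + b) + autocorr f a * d b x))"
    unfolding Q_def sq_mean_cmult[OF continuous_u[OF f(1)], symmetric]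
    by (simp add: d_def algebra_simps)
  also have "\<dots> \<le> 2 * sq_mean (\<lambda>x. (-1) * d (a + b) x)
      + 2 * sq_mean (\<lambda>x. d a (x + b) + autocorr f a * d b x)"
    by (rule sq_mean_add_le) (intro continuity cont)+
  also have "sq_mean (\<lambda>x. (-1) * d (a + b) x) = sq_mean (d (a + b))"
    by (simp only: sq_mean_cmult[OF cont]) simp
  finally have "(cmod (autocorr f (a + b) - autocorr f a * autocorr f b))\<^sup>2 * Q f
      \<le> 2 * sq_mean (d (a + b)) + 2 * sq_mean (\<lambda>x. d a (x + b) + autocorr f a * d b x)" .
  moreover have "sq_mean (\<lambda>x. d a (x + b) + autocorr f a * d b x)
      \<le> 2 * sq_mean (\<lambda>x. d a (x + b)) + 2 * sq_mean (\<lambda>x. autocorr f a * d b x)"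
    by (rule sq_mean_add_le) (intro continuity cont)+
  moreover have "sq_mean (\<lambda>x. d a (x + b)) = sq_mean (d a)"
    by (rule sq_mean_translate[OF cont])
  moreover have "sq_mean (\<lambda>x. autocorr f a * d b x) \<le> 1 * sq_mean (d b)"
    unfolding sq_mean_cmult[OF cont]
    using norm_autocorr_le[OF f(1), of a] f(2) sq_mean_nonneg[OF cont]
    by (intro mult_right_mono) (auto simp: power_le_one)
  ultimately show ?thesis using d[of "a + b"] d[of a] d[of b] by linarith
qed

text \<open>Moving the difference operator to the other factor writes \<open>Q f\<close> as the
  inner product of \<open>C f\<close> with an increment of \<open>u f\<close> under
  \<open>- a\<^sub>0\<close>. Bounding \<open>C f\<close> by \<open>W\<close> and splitting the
  product with the free parameter \<open>t\<close> shows that near invariance of \<open>u f\<close>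
  forces \<open>Q f\<close> to be small.\<close>

lemma Q_le_translation_diff:
  assumes "admissible f" "t > 0"
  shows "Q f \<le> (t * W\<^sup>2 + sq_mean (\<lambda>x. u f (x + - a\<^sub>0) - u f x) / t) / 2"
proof -
  have f: "continuous_on UNIV f" "sq_mean f = 1" using assms by (auto simp: admissible_def)
  note cont = continuous_u[OF f(1)] continuous_C[OF f(1)]
  have "continuous_on UNIV (\<lambda>x. C f x * cnj (u f x))"
    "continuous_on UNIV (\<lambda>x. C f x * cnj (u f (x + - a\<^sub>0)))"
    by (intro continuity cont)+
  then obtain p q where p: "has_mean (\<lambda>x. C f x * cnj (u f x)) p"
    and q: "has_mean (\<lambda>x. C f x * cnj (u f (x + - a\<^sub>0))) q"
    using has_mean_complex by blast
  have "has_mean (\<lambda>x. C f (x + a\<^sub>0) * cnj (u f (x + a\<^sub>0 + - a\<^sub>0))) q"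
    by (rule has_mean_shift[OF q])
  then have "has_mean (\<lambda>x. C f x * cnj (u f x) - C f (x + a\<^sub>0) * cnj (u f x)) (p - q)"
    by (intro has_mean_diff p) simp
  then have "has_mean (\<lambda>x. of_real ((cmod (u f x))\<^sup>2)) (p - q)"
    unfolding left_diff_distrib[symmetric] u_def[symmetric] complex_norm_square .
  moreover have "has_mean (\<lambda>x. complex_of_real ((cmod (u f x))\<^sup>2)) (of_real (Q f))"
    unfolding Q_def by (intro has_mean_bounded_linear[OF bounded_linear_of_real] has_mean_sq_mean cont)
  ultimately have "complex_of_real (Q f) = p - q"
    using has_mean_unique by blast
  then have "Q f \<le> cmod (q - p)" by (metis abs_ge_self norm_minus_commute norm_of_real order.trans)
  also have "cmod (q - p) \<le> (t * W\<^sup>2 + sq_mean (\<lambda>x. u f (x + - a\<^sub>0) - u f x) * (1 / t)) * (1 / 2)"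
  proof (rule has_mean_norm_le_mean[OF has_mean_diff[OF q p]])
    show "has_mean (\<lambda>x. (t * W\<^sup>2 + (cmod (u f (x + - a\<^sub>0) - u f x))\<^sup>2 * (1 / t)) * (1 / 2))
        ((t * W\<^sup>2 + sq_mean (\<lambda>x. u f (x + - a\<^sub>0) - u f x) * (1 / t)) * (1 / 2))"
      by (intro has_mean_bounded_linear[OF bounded_linear_mult_left] has_mean_add has_mean_const
          has_mean_sq_mean continuity cont)
    fix x
    define y where "y = cmod (u f (x + - a\<^sub>0) - u f x)"
    have "cmod (C f x * cnj (u f (x + - a\<^sub>0)) - C f x * cnj (u f x)) = cmod (C f x) * y"
      unfolding y_def right_diff_distrib[symmetric] norm_mult complex_cnj_diff[symmetric] complex_mod_cnj ..
    also have "\<dots> \<le> W * y"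
      using norm_C_le[OF f(1), of x] f(2) by (intro mult_right_mono) (auto simp: y_def)
    also have "W * y \<le> (t * W\<^sup>2 + y\<^sup>2 * (1 / t)) * (1 / 2)"
    proof -
      have "0 \<le> (t * W - y)\<^sup>2 / t" using assms(2) by simp
      also have "\<dots> = t * W\<^sup>2 + y\<^sup>2 * (1 / t) - 2 * (W * y)"
        using assms(2) by (simp add: field_simps power2_eq_square)
      finally show ?thesis by simp
    qed
    finally show "cmod (C f x * cnj (u f (x + - a\<^sub>0)) - C f x * cnj (u f x))
        \<le> (t * W\<^sup>2 + (cmod (u f (x + - a\<^sub>0) - u f x))\<^sup>2 * (1 / t)) * (1 / 2)"
      by (simp add: y_def)
  qed
  finally show ?thesis by simp
qed

text \<open>As \<open>\<gamma>\<close> is only a cluster point of a maximizing sequence, the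
  convergent sequence depends on \<open>Y\<close>. Each later property of \<open>\<gamma>\<close>
  involves finitely many points at a time and is proved along a sequence chosen for them.\<close>

lemma maximizing_character:
  obtains \<gamma> where "\<And>Y. finite Y \<Longrightarrow> \<exists>g. (\<forall>n. admissible (g n)) \<and> (\<lambda>n. Q (g n)) \<longlonglongrightarrow> s
      \<and> (\<forall>y\<in>Y. (\<lambda>n. autocorr (g n) y) \<longlonglongrightarrow> \<gamma> y)"
proof -
  have "admissible (\<lambda>_. 1)"
    unfolding admissible_def sq_mean_def by (auto intro!: mean_eqI has_mean_const)
  then have ne: "Q ` Collect admissible \<noteq> {}" by blast
  have "\<forall>n. \<exists>f. admissible f \<and> s - 1 / real (Suc n) < Q f"
  proof
    fix n
    have "s - 1 / real (Suc n) < s" by simp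
    then show "\<exists>f. admissible f \<and> s - 1 / real (Suc n) < Q f"
      using less_cSupD[OF ne, of "s - 1 / real (Suc n)"] unfolding s_def by blast
  qed
  from choice[OF this] obtain f where f: "\<And>n. admissible (f n)" "\<And>n. s - 1 / real (Suc n) < Q (f n)"
    by blast
  have "cmod (autocorr (f n) x) \<le> 1" for n x
    using norm_autocorr_le[of "f n" x] f(1)[of n] by (auto simp: admissible_def)
  then obtain \<gamma> where \<gamma>: "\<And>Y e m. finite Y \<Longrightarrow> e > 0 \<Longrightarrow> \<exists>n\<ge>m. \<forall>y\<in>Y. dist (autocorr (f n) y) (\<gamma> y) < e"
    using pointwise_cluster_point[of "\<lambda>n. autocorr (f n)"] by blast
  show ?thesis
  proof (rule that)
    fix Y :: "'a set" assume Y: "finite Y"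
    have "\<forall>m. \<exists>n. m \<le> n \<and> (\<forall>y\<in>Y. dist (autocorr (f n) y) (\<gamma> y) < 1 / real (Suc m))"
    proof
      show "\<exists>n. m \<le> n \<and> (\<forall>y\<in>Y. dist (autocorr (f n) y) (\<gamma> y) < 1 / real (Suc m))" for m
        using \<gamma>[OF Y, of "1 / real (Suc m)" m] by auto
    qed
    from choice[OF this] obtain k where k: "\<And>m. m \<le> k m"
      "\<And>m y. y \<in> Y \<Longrightarrow> dist (autocorr (f (k m)) y) (\<gamma> y) < 1 / real (Suc m)"
      by blast
    have lim0: "(\<lambda>m. 1 / real (Suc m)) \<longlonglongrightarrow> 0"
      using LIMSEQ_inverse_real_of_nat by (simp add: divide_inverse)
    have "(\<lambda>m. autocorr (f (k m)) y) \<longlonglongrightarrow> \<gamma> y" if "y \<in> Y" for y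
      by (rule tendsto_dist_iff[THEN iffD2], rule tendsto_sandwich[OF _ _ tendsto_const lim0])
         (use k(2)[OF that] in \<open>auto intro!: always_eventually less_imp_le\<close>)
    moreover have "(\<lambda>m. Q (f (k m))) \<longlonglongrightarrow> s"
    proof (rule tendsto_sandwich)
      show "\<forall>\<^sub>F m in sequentially. s - 1 / real (Suc m) \<le> Q (f (k m))"
      proof (intro always_eventually allI)
        fix m
        have "1 / real (Suc (k m)) \<le> 1 / real (Suc m)"
          using k(1)[of m] by (intro divide_left_mono) auto
        then show "s - 1 / real (Suc m) \<le> Q (f (k m))" using f(2)[of "k m"] by linarith
      qed
      show "(\<lambda>m. s - 1 / real (Suc m)) \<longlonglongrightarrow> s"
        using tendsto_diff[OF tendsto_const[of s] lim0] by simp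
    qed (use f(1) Q_le_s in auto)
    ultimately show "\<exists>g. (\<forall>n. admissible (g n)) \<and> (\<lambda>n. Q (g n)) \<longlonglongrightarrow> s
      \<and> (\<forall>y\<in>Y. (\<lambda>n. autocorr (g n) y) \<longlonglongrightarrow> \<gamma> y)"
      using f(1) by (intro exI[of _ "\<lambda>m. f (k m)"]) blast
  qed
qed

lemma nontrivial_character:
  assumes "continuous_on UNIV f" "Q f > 0"
  obtains \<gamma> :: "'a \<Rightarrow> complex" where "continuous_on UNIV \<gamma>" "\<And>x. cmod (\<gamma> x) = 1"
    "\<And>x y. \<gamma> (x + y) = \<gamma> x * \<gamma> y" "\<gamma> a\<^sub>0 \<noteq> 1"
proof -
  have "0 < s * (sq_mean f)\<^sup>2" using assms Q_le[of f] by linarith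
  then have s: "s > 0" by (simp add: zero_less_mult_iff)
  obtain \<gamma> where \<gamma>: "\<And>Y. finite Y \<Longrightarrow> \<exists>g. (\<forall>n. admissible (g n)) \<and> (\<lambda>n. Q (g n)) \<longlonglongrightarrow> s
      \<and> (\<forall>y\<in>Y. (\<lambda>n. autocorr (g n) y) \<longlonglongrightarrow> \<gamma> y)"
    using maximizing_character by blast
  have zero: "\<gamma> 0 = 1"
  proof -
    obtain g where g: "\<And>n. admissible (g n)" "(\<lambda>n. autocorr (g n) 0) \<longlonglongrightarrow> \<gamma> 0"
      using \<gamma>[of "{0}"] by auto
    have "autocorr (g n) 0 = 1" for n
      using g(1)[of n] by (simp add: autocorr_0 admissible_def)
    with g(2) show ?thesis by (simp add: LIMSEQ_const_iff)
  qed
  have le1: "cmod (\<gamma> a) \<le> 1" for a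
  proof -
    obtain g where g: "\<And>n. admissible (g n)" "(\<lambda>n. autocorr (g n) a) \<longlonglongrightarrow> \<gamma> a"
      using \<gamma>[of "{a}"] by auto
    have "cmod (autocorr (g n) a) \<le> 1" for n
      using norm_autocorr_le[of "g n" a] g(1)[of n] by (auto simp: admissible_def)
    then show ?thesis
      using LIMSEQ_le_const2[OF tendsto_norm[OF g(2)]] by blast
  qed
  have mult: "\<gamma> (a + b) = \<gamma> a * \<gamma> b" for a b
  proof -
    obtain g where g: "\<And>n. admissible (g n)" "(\<lambda>n. Q (g n)) \<longlonglongrightarrow> s"
      "(\<lambda>n. autocorr (g n) a) \<longlonglongrightarrow> \<gamma> a" "(\<lambda>n. autocorr (g n) b) \<longlonglongrightarrow> \<gamma> b"
      "(\<lambda>n. autocorr (g n) (a + b)) \<longlonglongrightarrow> \<gamma> (a + b)"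
      using \<gamma>[of "{a, b, a + b}"] by auto
    have "(cmod (\<gamma> (a + b) - \<gamma> a * \<gamma> b))\<^sup>2 * s \<le> 40 * (s - s)"
    proof (rule LIMSEQ_le)
      show "(\<lambda>n. (cmod (autocorr (g n) (a + b) - autocorr (g n) a * autocorr (g n) b))\<^sup>2 * Q (g n))
          \<longlonglongrightarrow> (cmod (\<gamma> (a + b) - \<gamma> a * \<gamma> b))\<^sup>2 * s"
        by (intro tendsto_intros g)
      show "(\<lambda>n. 40 * (s - Q (g n))) \<longlonglongrightarrow> 40 * (s - s)"
        by (intro tendsto_intros g)
    qed (use almost_multiplicative[OF g(1)] in blast)
    then show ?thesis using s by (simp add: mult_le_0_iff)
  qed
  have norm1: "cmod (\<gamma> a) = 1" for a
  proof -
    have "cmod (\<gamma> a) * cmod (\<gamma> (- a)) = 1"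
      using mult[of a "- a"] zero by (simp flip: norm_mult)
    moreover have "cmod (\<gamma> a) * cmod (\<gamma> (- a)) \<le> cmod (\<gamma> a) * 1"
      using le1[of "- a"] by (intro mult_left_mono) auto
    ultimately show ?thesis using le1[of a] by linarith
  qed
  have cont: "continuous_on UNIV \<gamma>"
  proof (rule continuous_onI_uniform)
    fix e :: real assume e: "e > 0"
    \<comment> \<open>With this choice the limiting bound \<open>2 * (2 * d)\<^sup>2\<close> equals
      \<open>8 / 9 * e\<^sup>2 * s\<close>, hence is at most \<open>e\<^sup>2 * s\<close>.\<close>
    define d where "d = e * sqrt s / 3"
    have d: "d > 0" using e s by (simp add: d_def)
    from uniform_continuity[OF cont_w this]
    show "\<forall>\<^sub>F a in nhds 0. \<forall>x. cmod (\<gamma> (x + a) - \<gamma> x) \<le> e"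
    proof eventually_elim
      case (elim a)
      obtain g where g: "\<And>n. admissible (g n)" "(\<lambda>n. Q (g n)) \<longlonglongrightarrow> s"
        "(\<lambda>n. autocorr (g n) a) \<longlonglongrightarrow> \<gamma> a"
        using \<gamma>[of "{a}"] by auto
      have "(cmod (\<gamma> a - 1))\<^sup>2 * s \<le> 8 * (s - s) + 2 * (2 * d)\<^sup>2"
      proof (rule LIMSEQ_le)
        show "(\<lambda>n. (cmod (autocorr (g n) a - 1))\<^sup>2 * Q (g n)) \<longlonglongrightarrow> (cmod (\<gamma> a - 1))\<^sup>2 * s"
          by (intro tendsto_intros g)
        show "(\<lambda>n. 8 * (s - Q (g n)) + 2 * (2 * d)\<^sup>2) \<longlonglongrightarrow> 8 * (s - s) + 2 * (2 * d)\<^sup>2"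
          by (intro tendsto_intros g)
        have "(cmod (autocorr (g n) a - 1))\<^sup>2 * Q (g n) \<le> 8 * (s - Q (g n)) + 2 * (2 * d)\<^sup>2" for n
        proof -
          have gn: "continuous_on UNIV (g n)" "sq_mean (g n) = 1"
            using g(1)[of n] by (auto simp: admissible_def)
          have "cmod (u (g n) (x + a) - u (g n) x) \<le> 2 * d" for x
            using norm_u_diff_le[OF gn(1), of a d x] elim gn(2)
            by (auto simp: dist_norm intro: less_imp_le)
          then have "sq_mean (\<lambda>x. u (g n) (x + a) - u (g n) x) \<le> (2 * d)\<^sup>2"
            by (intro sq_mean_le continuity continuous_u gn)
          then show ?thesis using autocorr_diff_one_le[OF g(1), of n a] by linarith
        qed
        then show "\<exists>N. \<forall>n\<ge>N. (cmod (autocorr (g n) a - 1))\<^sup>2 * Q (g n) \<le> 8 * (s - Q (g n)) + 2 * (2 * d)\<^sup>2"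
          by blast
      qed
      also have "\<dots> \<le> e\<^sup>2 * s"
        using s e by (simp add: d_def power_mult_distrib power_divide)
      finally have "cmod (\<gamma> a - 1) \<le> e"
        using s e by (auto dest: power2_le_imp_le)
      moreover have "\<gamma> (x + a) - \<gamma> x = \<gamma> x * (\<gamma> a - 1)" for x
        by (simp add: mult algebra_simps)
      ultimately show ?case by (simp add: norm_mult norm1)
    qed
  qed
  have "\<gamma> a\<^sub>0 \<noteq> 1"
  proof
    assume "\<gamma> a\<^sub>0 = 1"
    then have inv: "\<gamma> (- a\<^sub>0) = 1" using mult[of a\<^sub>0 "- a\<^sub>0"] zero by simp
    obtain g where g: "\<And>n. admissible (g n)" "(\<lambda>n. Q (g n)) \<longlonglongrightarrow> s"
        "(\<lambda>n. autocorr (g n) (- a\<^sub>0)) \<longlonglongrightarrow> \<gamma> (- a\<^sub>0)"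
      using \<gamma>[of "{- a\<^sub>0}"] by auto
    \<comment> \<open>The limit is taken for fixed \<open>t\<close>. Both terms divided by
      \<open>t\<close> vanish in it because \<open>\<gamma> (- a\<^sub>0) = 1\<close>, which leaves
      \<open>s \<le> t * W\<^sup>2 / 2\<close>.\<close>
    have le: "s \<le> (t * W\<^sup>2 + (8 * (s - s) + 2 * ((cmod (\<gamma> (- a\<^sub>0) - 1))\<^sup>2 * s)) / t) / 2" if t: "t > 0" for t
    proof (rule LIMSEQ_le[OF g(2)])
      show "(\<lambda>n. (t * W\<^sup>2 + (8 * (s - Q (g n)) + 2 * ((cmod (autocorr (g n) (- a\<^sub>0) - 1))\<^sup>2 * Q (g n))) / t) / 2)
        \<longlonglongrightarrow> (t * W\<^sup>2 + (8 * (s - s) + 2 * ((cmod (\<gamma> (- a\<^sub>0) - 1))\<^sup>2 * s)) / t) / 2"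
        using t by (intro tendsto_intros g) auto
      have "Q (g n) \<le> (t * W\<^sup>2 + (8 * (s - Q (g n)) + 2 * ((cmod (autocorr (g n) (- a\<^sub>0) - 1))\<^sup>2 * Q (g n))) / t) / 2" for n
      proof -
        have "sq_mean (\<lambda>x. u (g n) (x + - a\<^sub>0) - u (g n) x) / t
            \<le> (8 * (s - Q (g n)) + 2 * ((cmod (autocorr (g n) (- a\<^sub>0) - 1))\<^sup>2 * Q (g n))) / t"
          using t translation_diff_le[OF g(1), of n "- a\<^sub>0"] by (intro divide_right_mono) auto
        then show ?thesis
          by (rule order.trans[OF Q_le_translation_diff[OF g(1) t] divide_right_mono[OF add_left_mono]])
            simp
      qed
      then show "\<exists>N. \<forall>n\<ge>N. Q (g n) \<le> (t * W\<^sup>2 + (8 * (s - Q (g n)) + 2 * ((cmod (autocorr (g n) (- a\<^sub>0) - 1))\<^sup>2 * Q (g n))) / t) / 2"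
        by blast
    qed
    \<comment> \<open>Small enough that \<open>t * W\<^sup>2 \<le> s\<close>; the summand one keeps
      the denominator positive even for \<open>W = 0\<close>.\<close>
    define t where "t = s / (1 + W\<^sup>2)"
    have W: "1 + W\<^sup>2 > 0" by (simp add: add_pos_nonneg)
    then have "t > 0" using s by (simp add: t_def)
    from le[OF this] have "2 * s \<le> t * W\<^sup>2" using inv by simp
    also have "\<dots> \<le> t * (1 + W\<^sup>2)" using \<open>t > 0\<close> by simp
    also have "\<dots> = s" using W by (simp add: t_def)
    finally show False using s by simp
  qed
  with cont norm1 mult show ?thesis using that by blast
qed

end

section \<open>Characters separate points\<close>

context compact_group
begin

text \<open>Three terms, because the convolution of a bump supported in \<open>U\<close> with its
  autocorrelation lives on \<open>U + U - U\<close>.\<close>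

lemma separating_neighborhood:
  assumes "(a::'a) \<noteq> 0"
  obtains U where "open U" "0 \<in> U" "\<And>x y z. x \<in> U \<Longrightarrow> y \<in> U \<Longrightarrow> z \<in> U \<Longrightarrow> x + y - z \<noteq> a"
proof -
  define f :: "'a \<times> 'a \<times> 'a \<Rightarrow> 'a" where "f p = fst p + fst (snd p) - snd (snd p)" for p
  have "open (f -` (- {a}))"
    unfolding f_def by (intro open_vimage continuous_intros)
  moreover have "(0, 0, 0) \<in> f -` (- {a})" using assms by (simp add: f_def)
  ultimately obtain A B where AB: "open A" "open B" "0 \<in> A" "(0, 0) \<in> B" "A \<times> B \<subseteq> f -` (- {a})"
    by (rule open_prod_elim) blast
  from AB(2,4) obtain C D where CD: "open C" "open D" "0 \<in> C" "0 \<in> D" "C \<times> D \<subseteq> B"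
    by (rule open_prod_elim) blast
  show ?thesis
  proof (rule that)
    show "open (A \<inter> C \<inter> D)" "0 \<in> A \<inter> C \<inter> D" using AB CD by auto
    fix x y z assume "x \<in> A \<inter> C \<inter> D" "y \<in> A \<inter> C \<inter> D" "z \<in> A \<inter> C \<inter> D"
    then have "(x, y, z) \<in> A \<times> B" using CD(5) by blast
    then have "(x, y, z) \<in> f -` (- {a})" using AB(5) by blast
    then show "x + y - z \<noteq> a" by (simp add: f_def)
  qed
qed

text \<open>A Urysohn bump serves as kernel and as trial function at once: \<open>C w\<close> has
  positive real part at zero and vanishes at \<open>a\<close> for support reasons, so
  \<open>u w\<close> is nonzero at zero and \<open>Q w > 0\<close>.\<close>

lemma complex_character_separates:
  assumes normal: "normal_space (euclidean :: 'a topology)" and "a \<noteq> 0"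
  obtains \<gamma> :: "'a \<Rightarrow> complex" where "continuous_on UNIV \<gamma>" "\<And>x. cmod (\<gamma> x) = 1"
    "\<And>x y. \<gamma> (x + y) = \<gamma> x * \<gamma> y" "\<gamma> a \<noteq> 1"
proof -
  obtain U where U: "open U" "0 \<in> U" "\<And>x y z. x \<in> U \<Longrightarrow> y \<in> U \<Longrightarrow> z \<in> U \<Longrightarrow> x + y - z \<noteq> a"
    using separating_neighborhood[OF assms(2)] by blast
  obtain g :: "'a \<Rightarrow> real" where g: "continuous_on UNIV g" "g ` (- U) \<subseteq> {0}" "g ` {0} \<subseteq> {1}"
  proof (rule Urysohn_lemma_alt[OF normal, of "- U" "{0}" 0 1])
    show "closedin euclidean (- U)" "closedin euclidean {0::'a}" "disjnt (- U) {0}"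
      using U by (auto simp: disjnt_def)
  qed (use that in auto)
  \<comment> \<open>The absolute value secures nonnegativity, so that no cancellation can occur in
    the means below.\<close>
  define f where "f x = \<bar>g x\<bar>" for x
  have f: "continuous_on UNIV f" "\<And>x. 0 \<le> f x" "f 0 = 1" "\<And>x. f x \<noteq> 0 \<Longrightarrow> x \<in> U"
    using g by (auto simp: f_def intro: continuous_intros)
  define w where "w x = complex_of_real (f x)" for x
  have w: "continuous_on UNIV w" unfolding w_def by (intro continuous_intros f)
  obtain W where W: "\<forall>x. cmod (w x) \<le> W" using bounded_continuous[OF w] by blast
  interpret variational type w W a
    by unfold_locales (use w W in auto)
  have autocorr_w: "has_mean (\<lambda>y. f (y + x) * f y) (Re (autocorr w x))" for x
    using has_mean_bounded_linear[OF bounded_linear_Re has_mean_autocorr[OF w]] by (simp add: w_def)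
  have nonneg: "0 \<le> Re (autocorr w x)" for x
    by (rule has_mean_nonneg[OF autocorr_w]) (simp add: f)
  have "0 < Re (autocorr w 0)"
    by (rule has_mean_pos[OF _ _ _ autocorr_w, of _ 0]) (auto intro!: continuous_intros f simp: f)
  have "0 < Re (C w 0)"
  proof (rule has_mean_pos)
    show "has_mean (\<lambda>z. f (0 - z) * Re (autocorr w z)) (Re (C w 0))"
      using has_mean_bounded_linear[OF bounded_linear_Re has_mean_conv[OF w continuous_autocorr[OF w], of 0]]
      by (simp add: C_def w_def)
    show "0 < f (0 - 0) * Re (autocorr w 0)" using \<open>0 < Re (autocorr w 0)\<close> f by simp
    show "continuous_on UNIV (\<lambda>z. f (0 - z) * Re (autocorr w z))"
      by (intro continuous_on_mult continuous_reflect f continuous_on_Re continuous_autocorr w)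
  qed (simp add: f nonneg)
  moreover have "C w a = 0"
  proof -
    have zero: "w (a - z) * autocorr w z = 0" for z
    proof (rule ccontr)
      assume *: "w (a - z) * autocorr w z \<noteq> 0"
      then have "a - z \<in> U" using f(4) by (auto simp: w_def)
      obtain y where "w (y + z) * cnj (w y) \<noteq> 0"
      proof (rule ccontr)
        assume "\<not> thesis"
        then have "\<And>y. w (y + z) * cnj (w y) = 0" using that by blast
        then have "autocorr w z = 0"
          unfolding autocorr_def by (simp only: mean_eqI[OF has_mean_const])
        then show False using * by simp
      qed
      then have "y + z \<in> U" "y \<in> U" using f(4) by (auto simp: w_def)
      then have "(a - z) + (y + z) - y \<noteq> a" by (intro U \<open>a - z \<in> U\<close>)
      then show False by simp
    qed
    show ?thesis
      unfolding C_def conv_def zero by (rule mean_eqI[OF has_mean_const])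
  qed
  ultimately have "u w 0 \<noteq> 0" by (auto simp: u_def)
  have "0 < Q w"
  proof (rule has_mean_pos)
    show "has_mean (\<lambda>x. (cmod (u w x))\<^sup>2) (Q w)"
      unfolding Q_def by (intro has_mean_sq_mean continuous_u w)
    show "0 < (cmod (u w 0))\<^sup>2" using \<open>u w 0 \<noteq> 0\<close> by simp
  qed (auto intro!: continuous_intros continuous_u w)
  with w show ?thesis using nontrivial_character that by blast
qed

end

section \<open>The dual group\<close>

lift_definition circle_exp :: "circle \<Rightarrow> complex" is "\<lambda>x. cis (2 * pi * x)"
proof -
  fix x y :: real
  assume "x - y \<in> \<int>"
  then obtain n where n: "x = y + of_int n" by (metis Ints_cases add_diff_cancel_left' diff_add_cancel add.commute)
  have "2 * pi * x = 2 * pi * y + 2 * pi * of_int n" unfolding n by (simp add: algebra_simps)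
  then show "cis (2 * pi * x) = cis (2 * pi * y)"
    by (simp add: cis_mult[symmetric] cis_multiple_2pi)
qed

lemma circle_exp_add: "circle_exp (a + b) = circle_exp a * circle_exp b"
  by transfer (simp add: cis_mult algebra_simps)

lemma circle_exp_0 [simp]: "circle_exp 0 = 1"
  by transfer simp

lemma norm_circle_exp [simp]: "cmod (circle_exp a) = 1"
  by transfer simp

lemma circle_exp_eq_1_iff: "circle_exp a = 1 \<longleftrightarrow> a = 0"
proof transfer
  fix x :: real
  have "cis (2 * pi * x) = 1 \<longleftrightarrow> (\<exists>n. 2 * pi * x = 2 * pi * of_int n)"
    by (auto simp: cis_conv_exp exp_eq_1 algebra_simps)
  also have "\<dots> \<longleftrightarrow> x - 0 \<in> \<int>" by (auto simp: Ints_def)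
  finally show "cis (2 * pi * x) = 1 \<longleftrightarrow> x - 0 \<in> \<int>" .
qed

lemma circle_exp_minus: "circle_exp (- a) * circle_exp a = 1"
  by (simp flip: circle_exp_add)

lemma circle_exp_eq_iff: "circle_exp a = circle_exp b \<longleftrightarrow> a = b"
proof
  assume "circle_exp a = circle_exp b"
  then have "circle_exp (- b + a) = 1" by (simp only: circle_exp_add circle_exp_minus)
  then show "a = b" by (simp add: circle_exp_eq_1_iff)
qed simp

lemma circle_exp_surj:
  assumes "cmod z = 1"
  shows "\<exists>a. circle_exp a = z"
proof -
  have "z \<noteq> 0" using assms by auto
  then have "cis (Arg z) = z" using cis_Arg[of z] assms by (simp add: sgn_div_norm)
  then have "circle_exp (to_circle (Arg z / (2 * pi))) = z"
    by (simp add: circle_exp.abs_eq)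
  then show ?thesis ..
qed

lemma continuous_to_circle: "continuous_on S to_circle"
  by (rule continuous_on_subset[of UNIV]) (auto simp: continuous_on_open_vimage open_circle_def)

lemma continuous_circle_exp: "continuous_on UNIV circle_exp"
proof -
  have "open (circle_exp -` V)" if "open V" for V
  proof -
    have "to_circle -` (circle_exp -` V) = (\<lambda>x. cis (2 * pi * x)) -` V"
      by (auto simp: circle_exp.abs_eq)
    moreover have "open ((\<lambda>x. cis (2 * pi * x)) -` V)"
      by (intro open_vimage that continuous_intros)
    ultimately show ?thesis by (simp add: open_circle_def)
  qed
  then show ?thesis by (simp add: continuous_on_open_vimage)
qed

lemma compact_circle: "compact (UNIV :: circle set)"
proof -
  have "UNIV = to_circle ` {0..1}"
  proof -
    have "a \<in> to_circle ` {0..1}" for a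
    proof -
      obtain x where x: "a = to_circle x" using surj_to_circle by blast
      have "a = to_circle (frac x)" unfolding x to_circle_eq_iff by (simp add: frac_def)
      moreover have "frac x \<in> {0..1}" using frac_ge_0[of x] frac_lt_1[of x] by simp
      ultimately show ?thesis by blast
    qed
    then show ?thesis by blast
  qed
  then show ?thesis
    by (metis compact_continuous_image continuous_to_circle compact_Icc)
qed

text \<open>The compactness of the circle makes \<open>circle_exp\<close> a closed map. Together
  with injectivity this moves continuity and neighbourhoods of zero between the circle and the
  complex unit circle.\<close>

lemma closed_circle_exp_image: "closed S \<Longrightarrow> closed (circle_exp ` S)"
  by (metis closed_UNIV compact_Int_closed compact_circle compact_continuous_image compact_imp_closed
      continuous_circle_exp continuous_on_subset inf_top_left subset_UNIV)

lemma dual_group_zero: "(\<lambda>_. 0) \<in> dual_group"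
  by (simp add: dual_group_def Modules.additive_def)

lemma dual_group_add:
  "\<phi> \<in> dual_group \<Longrightarrow> \<psi> \<in> dual_group \<Longrightarrow> (\<lambda>x. \<phi> x + \<psi> x) \<in> dual_group"
  by (simp add: dual_group_def Modules.additive_def continuous_on_add ac_simps)

lemma dual_group_minus: "\<phi> \<in> dual_group \<Longrightarrow> (\<lambda>x. - \<phi> x) \<in> dual_group"
  by (simp add: dual_group_def Modules.additive_def continuous_on_minus)

lemma dual_group_diff:
  assumes "\<phi> \<in> dual_group" "\<psi> \<in> dual_group"
  shows "(\<lambda>x. \<phi> x - \<psi> x) \<in> dual_group"
  using dual_group_add[OF assms(1) dual_group_minus[OF assms(2)]] by simp

text \<open>A type of its own makes the characters an instance of \<open>ab_group_add\<close>, so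
  that averages and means apply to functions on the dual.\<close>

typedef (overloaded) ('a::topological_ab_group_add) dual = "dual_group :: ('a \<Rightarrow> circle) set"
  morphisms dual_fun Dual
  using dual_group_zero by blast

setup_lifting type_definition_dual

instantiation dual :: (topological_ab_group_add) ab_group_add
begin

lift_definition zero_dual :: "'a dual" is "\<lambda>_. 0"
  by (rule dual_group_zero)

lift_definition plus_dual :: "'a dual \<Rightarrow> 'a dual \<Rightarrow> 'a dual" is "\<lambda>\<phi> \<psi> x. \<phi> x + \<psi> x"
  by (rule dual_group_add)

lift_definition uminus_dual :: "'a dual \<Rightarrow> 'a dual" is "\<lambda>\<phi> x. - \<phi> x"
  by (rule dual_group_minus)

lift_definition minus_dual :: "'a dual \<Rightarrow> 'a dual \<Rightarrow> 'a dual" is "\<lambda>\<phi> \<psi> x. \<phi> x - \<psi> x"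
  by (rule dual_group_diff)

instance
proof
  fix \<phi> \<psi> \<theta> :: "'a dual"
  show "\<phi> + \<psi> + \<theta> = \<phi> + (\<psi> + \<theta>)" by transfer (simp add: add.assoc)
  show "\<phi> + \<psi> = \<psi> + \<phi>" by transfer (simp add: add.commute)
  show "0 + \<phi> = \<phi>" by transfer simp
  show "- \<phi> + \<phi> = 0" by transfer simp
  show "\<phi> - \<psi> = \<phi> + - \<psi>" by transfer simp
qed

end

definition ev :: "'a::topological_ab_group_add dual \<Rightarrow> 'a \<Rightarrow> complex"
  where "ev \<phi> x = circle_exp (dual_fun \<phi> x)"

lemma dual_fun_add: "dual_fun \<phi> (x + y) = dual_fun \<phi> x + dual_fun \<phi> y"
  using dual_fun[of \<phi>] by (simp add: dual_group_def Modules.additive_def)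

lemma ev_add: "ev \<phi> (x + y) = ev \<phi> x * ev \<phi> y"
  by (simp add: ev_def dual_fun_add circle_exp_add)

lemma ev_plus: "ev (\<phi> + \<psi>) x = ev \<phi> x * ev \<psi> x"
  by (simp add: ev_def plus_dual.rep_eq circle_exp_add)

lemma ev_zero [simp]: "ev 0 x = 1"
  by (simp add: ev_def zero_dual.rep_eq)

lemma norm_ev [simp]: "cmod (ev \<phi> x) = 1"
  by (simp add: ev_def)

lemma ev_0 [simp]: "ev \<phi> 0 = 1"
proof -
  have "ev \<phi> 0 * ev \<phi> 0 = ev \<phi> 0" by (simp flip: ev_add)
  moreover have "ev \<phi> 0 \<noteq> 0" using norm_ev[of \<phi> 0] by force
  ultimately show ?thesis by simp
qed

lemma ev_diff: "ev \<phi> (x - y) = ev \<phi> x * cnj (ev \<phi> y)"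
proof -
  have "ev \<phi> (x - y) * ev \<phi> y = ev \<phi> x" by (simp flip: ev_add)
  then have "ev \<phi> (x - y) * (ev \<phi> y * cnj (ev \<phi> y)) = ev \<phi> x * cnj (ev \<phi> y)"
    by (metis mult.assoc)
  then show ?thesis by (simp flip: complex_norm_square)
qed

lemma continuous_ev: "continuous_on UNIV (ev \<phi>)"
  unfolding ev_def using dual_fun[of \<phi>]
  by (intro continuous_on_compose2[OF continuous_circle_exp]) (auto simp: dual_group_def)

lemma ev_nontrivial:
  assumes "\<phi> \<noteq> 0"
  shows "\<exists>x. ev \<phi> x \<noteq> 1"
proof -
  have "dual_fun \<phi> \<noteq> dual_fun 0" using assms by (simp add: dual_fun_inject)
  then show ?thesis by (auto simp: fun_eq_iff zero_dual.rep_eq ev_def circle_exp_eq_1_iff)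
qed

text \<open>The complex character lifts through the bijection from the circle onto the complex unit
  circle; the lift is continuous because \<open>circle_exp\<close> is closed.\<close>

lemma (in compact_group) ev_separates:
  assumes "normal_space (euclidean :: 'a topology)" and "(a::'a) \<noteq> 0"
  shows "\<exists>\<phi>. ev \<phi> a \<noteq> 1"
proof -
  obtain \<gamma> where \<gamma>: "continuous_on UNIV \<gamma>" "\<And>x. cmod (\<gamma> x) = 1"
    "\<And>x y. \<gamma> (x + y) = \<gamma> x * \<gamma> y" "\<gamma> a \<noteq> 1"
    using complex_character_separates[OF assms] by blast
  have "\<forall>x. \<exists>t. circle_exp t = \<gamma> x" using circle_exp_surj \<gamma>(2) by blast
  from choice[OF this] obtain \<phi> where \<phi>: "\<And>x. circle_exp (\<phi> x) = \<gamma> x" by blast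
  have "closed (\<phi> -` S)" if "closed S" for S
  proof -
    have "\<phi> -` S = \<gamma> -` (circle_exp ` S)"
      by (auto simp: \<phi>[symmetric] circle_exp_eq_iff)
    then show ?thesis
      using closed_vimage[OF closed_circle_exp_image[OF that] \<gamma>(1)] by simp
  qed
  then have "continuous_on UNIV \<phi>" by (simp add: continuous_on_closed_vimage)
  moreover have "Modules.additive \<phi>"
    by (rule Modules.additive.intro) (simp add: \<phi> \<gamma>(3) circle_exp_add flip: circle_exp_eq_iff)
  ultimately have "\<phi> \<in> dual_group" by (simp add: dual_group_def)
  then have "ev (Dual \<phi>) a = \<gamma> a" by (simp add: ev_def Dual_inverse \<phi>)
  then show ?thesis using \<gamma>(4) by metis
qed

section \<open>Bohr neighbourhoods in the dual group\<close>

definition multiple :: "nat \<Rightarrow> 'g::ab_group_add \<Rightarrow> 'g"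
  where "multiple k x = ((+) x ^^ k) 0"

lemma ev_multiple: "ev \<phi> (multiple k x) = ev \<phi> x ^ k"
  by (induction k) (simp_all add: multiple_def ev_add)

lemma ev_multiple_dual: "ev (multiple k \<phi>) x = ev \<phi> x ^ k"
  by (induction k) (simp_all add: multiple_def ev_plus)

lemma ev_sum: "ev \<phi> (\<Sum>h\<in>F. z h) = (\<Prod>h\<in>F. ev \<phi> (z h))"
  by (induction F rule: infinite_finite_induct) (simp_all add: ev_add)

text \<open>Orthogonality of characters on the dual. Averaging over the first \<open>N\<close>
  multiples of \<open>\<gamma>\<close> produces a geometric sum bounded by
  \<open>2 / cmod (1 - z)\<close>, which division by \<open>N\<close> makes small uniformly in
  \<open>\<phi>\<close>.\<close>

lemma has_mean_ev_nonzero: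
  fixes x :: "'a::topological_ab_group_add"
  assumes "ev \<gamma> x \<noteq> 1"
  shows "has_mean (\<lambda>\<phi>. ev \<phi> x) 0"
  unfolding has_mean_def
proof (intro allI impI)
  fix e :: real assume e: "e > 0"
  define z where "z = ev \<gamma> x"
  have z: "cmod z = 1" "cmod (1 - z) > 0" using assms by (auto simp: z_def)
  obtain N where N: "2 / (cmod (1 - z) * e) < real N" using reals_Archimedean2 by blast
  have "0 < 2 / (cmod (1 - z) * e)" using z e by simp
  with N have N0: "N > 0" by (metis less_trans of_nat_0_less_iff)
  define A where "A = map (\<lambda>k. multiple k \<gamma>) [0..<N]"
  have "norm (avg A (\<lambda>\<phi>. ev \<phi> x) \<phi> - 0) \<le> e" for \<phi>
  proof -
    have "(\<Sum>a\<leftarrow>A. ev (\<phi> + a) x) = (\<Sum>k<N. ev \<phi> x * z ^ k)"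
      by (simp add: A_def o_def ev_plus ev_multiple_dual z_def interv_sum_list_conv_sum_set_nat
          lessThan_atLeast0)
    then have "(\<Sum>a\<leftarrow>A. ev (\<phi> + a) x) = ev \<phi> x * (\<Sum>k<N. z ^ k)"
      by (simp only: sum_distrib_left)
    then have avg: "norm (avg A (\<lambda>\<phi>. ev \<phi> x) \<phi>) = cmod (\<Sum>k<N. z ^ k) / real N"
      by (simp add: avg_def A_def norm_mult divide_inverse)
    have "cmod (1 - z) * cmod (\<Sum>k<N. z ^ k) \<le> 2"
    proof -
      have "cmod (1 - z) * cmod (\<Sum>k<N. z ^ k) = cmod (1 - z ^ N)"
        unfolding norm_mult[symmetric] one_diff_power_eq ..
      also have "\<dots> \<le> 1 + cmod (z ^ N)" using norm_triangle_ineq4[of 1 "z ^ N"] by simp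
      also have "\<dots> = 2" using z by (simp add: norm_power)
      finally show ?thesis .
    qed
    then have "cmod (\<Sum>k<N. z ^ k) \<le> 2 / cmod (1 - z)"
      using z by (simp add: field_simps)
    also have "\<dots> \<le> e * real N" using N z e by (simp add: field_simps)
    finally have "cmod (\<Sum>k<N. z ^ k) / real N \<le> e" using N0 by (simp add: field_simps)
    then show ?thesis using avg by simp
  qed
  then show "\<exists>A. A \<noteq> [] \<and> (\<forall>\<phi>. norm (avg A (\<lambda>\<phi>. ev \<phi> x) \<phi> - 0) \<le> e)"
    using N0 by (intro exI[of _ A]) (auto simp: A_def)
qed

section \<open>The binomial kernel and its Fourier coefficients\<close>

definition binomial_kernel :: "'a::topological_ab_group_add set \<Rightarrow> 'a dual \<Rightarrow> complex"
  where "binomial_kernel F \<phi> = (\<Prod>h\<in>F. (1 + ev \<phi> h) / 2)"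

definition binomial_weight :: "'a set \<Rightarrow> nat \<Rightarrow> ('a \<Rightarrow> nat) \<Rightarrow> real"
  where "binomial_weight F N n = (\<Prod>h\<in>F. real (N choose n h) / 2 ^ N)"

definition combination :: "'a::ab_group_add set \<Rightarrow> ('a \<Rightarrow> nat) \<Rightarrow> 'a"
  where "combination F n = (\<Sum>h\<in>F. multiple (n h) h)"

abbreviation exponents :: "'a set \<Rightarrow> nat \<Rightarrow> ('a \<Rightarrow> nat) set"
  where "exponents F N \<equiv> PiE F (\<lambda>_. {..N})"

text \<open>The mean over the dual of \<open>cmod (binomial_kernel F \<phi>) ^ (2 * N)\<close> times
  \<open>ev \<phi> x\<close>: the \<open>N\<close>-th power of the kernel and its conjugate are
  expanded, and orthogonality keeps the terms with total exponent zero.\<close>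

definition kernel_coeff :: "'a::ab_group_add set \<Rightarrow> nat \<Rightarrow> 'a \<Rightarrow> real"
  where "kernel_coeff F N x = (\<Sum>n\<in>exponents F N. \<Sum>m\<in>exponents F N.
    binomial_weight F N n * binomial_weight F N m *
    (if combination F n - combination F m + x = 0 then 1 else 0))"

lemma binomial_half_power:
  "((1 + z) / 2) ^ N = (\<Sum>k\<le>N. complex_of_real (real (N choose k) / 2 ^ N) * z ^ k)"
  by (simp add: power_divide add.commute[of 1] binomial_ring sum_divide_distrib)

lemma binomial_kernel_power:
  assumes "finite F"
  shows "binomial_kernel F \<phi> ^ N
    = (\<Sum>n\<in>exponents F N. complex_of_real (binomial_weight F N n) * ev \<phi> (combination F n))"
proof -
  have "binomial_kernel F \<phi> ^ N
      = (\<Prod>h\<in>F. \<Sum>k\<le>N. complex_of_real (real (N choose k) / 2 ^ N) * ev \<phi> h ^ k)"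
    unfolding binomial_kernel_def prod_power_distrib binomial_half_power ..
  also have "\<dots> = (\<Sum>n\<in>exponents F N. \<Prod>h\<in>F. complex_of_real (real (N choose n h) / 2 ^ N) * ev \<phi> h ^ n h)"
    by (rule prod_sum_PiE) (use assms in auto)
  also have "\<dots> = (\<Sum>n\<in>exponents F N. complex_of_real (binomial_weight F N n) * ev \<phi> (combination F n))"
    by (simp only: prod.distrib binomial_weight_def combination_def ev_sum ev_multiple of_real_prod)
  finally show ?thesis .
qed

text \<open>The expansion of the kernel evaluated at the trivial character.\<close>

lemma sum_binomial_weight:
  fixes F :: "'a::topological_ab_group_add set"
  assumes "finite F"
  shows "(\<Sum>n\<in>exponents F N. binomial_weight F N n) = 1"
proof -
  have "complex_of_real (\<Sum>n\<in>exponents F N. binomial_weight F N n) = binomial_kernel F 0 ^ N"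
    unfolding binomial_kernel_power[OF assms] by simp
  also have "\<dots> = 1" by (simp add: binomial_kernel_def)
  finally show ?thesis by (metis of_real_eq_1_iff)
qed

lemma binomial_weight_nonneg: "0 \<le> binomial_weight F N n"
  unfolding binomial_weight_def by (intro prod_nonneg) auto

lemma card_exponents: "finite F \<Longrightarrow> card (exponents F N) = Suc N ^ card F"
  by (simp add: card_PiE)

text \<open>There are \<open>Suc N ^ card F\<close> weights with sum one, so one of them is at least
  the reciprocal of their number. Its diagonal term alone gives the bound, since all terms are
  nonnegative.\<close>

lemma kernel_coeff_zero_ge:
  fixes F :: "'a::topological_ab_group_add set"
  assumes "finite F"
  shows "1 \<le> real (Suc N) ^ (2 * card F) * kernel_coeff F N 0"
proof -
  define I where "I = exponents F N"
  define M where "M = real (Suc N) ^ card F"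
  have I: "finite I" "real (card I) = M"
    using assms by (auto simp: I_def M_def card_exponents intro: finite_PiE)
  have M: "M > 0" by (simp add: M_def)
  have "\<exists>n\<in>I. 1 / M \<le> binomial_weight F N n"
  proof (rule ccontr)
    assume "\<not> ?thesis"
    then have less: "binomial_weight F N n < 1 / M" if "n \<in> I" for n using that by force
    have "I \<noteq> {}" using I M by auto
    then have "(\<Sum>n\<in>I. binomial_weight F N n) < (\<Sum>n\<in>I. 1 / M)"
      by (intro sum_strict_mono I less)
    then show False using I M sum_binomial_weight[OF assms, of N] by (simp add: I_def)
  qed
  then obtain n where n: "n \<in> I" "1 / M \<le> binomial_weight F N n" by blast
  define G where "G n m = binomial_weight F N n * binomial_weight F N m *
    (if combination F n - combination F m + 0 = 0 then 1 else 0)" for n m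
  have G: "0 \<le> G n m" for n m by (simp add: G_def binomial_weight_nonneg)
  have "(1 / M) * (1 / M) \<le> binomial_weight F N n * binomial_weight F N n"
    using n(2) M by (intro mult_mono) (auto simp: binomial_weight_nonneg)
  also have "\<dots> = G n n" by (simp add: G_def)
  also have "\<dots> \<le> (\<Sum>m\<in>I. G n m)"
    using n(1) I(1) G by (intro member_le_sum) auto
  also have "\<dots> \<le> (\<Sum>n\<in>I. \<Sum>m\<in>I. G n m)"
    using n(1) I(1) G by (intro member_le_sum[of n I "\<lambda>n. \<Sum>m\<in>I. G n m"]) (auto intro: sum_nonneg)
  also have "\<dots> = kernel_coeff F N 0"
    by (simp only: kernel_coeff_def G_def I_def)
  finally have "1 \<le> M * M * kernel_coeff F N 0" using M by (simp add: field_simps)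
  then show ?thesis by (simp add: M_def mult_2 power_add)
qed

lemma kernel_coeff_nonzero:
  assumes "kernel_coeff F N x \<noteq> 0"
  shows "\<exists>n\<in>exponents F N. \<exists>m\<in>exponents F N. x = combination F m - combination F n"
proof (rule ccontr)
  assume none: "\<not> ?thesis"
  have "combination F n - combination F m + x \<noteq> 0" if "n \<in> exponents F N" "m \<in> exponents F N" for n m
  proof
    assume "combination F n - combination F m + x = 0"
    then have "x = combination F m - combination F n" by (simp add: algebra_simps eq_neg_iff_add_eq_0)
    with that none show False by blast
  qed
  then have "kernel_coeff F N x = 0"
    unfolding kernel_coeff_def by (intro sum.neutral ballI) simp
  with assms show False ..
qed

text \<open>With \<open>r\<close> the root of \<open>q\<close> of order \<open>Suc k\<close>, the
  sequence \<open>real (Suc n) * r ^ n\<close> tends to zero; raise it to the power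
  \<open>Suc k\<close>. The successor keeps the order of the root nonzero.\<close>

lemma poly_times_geometric_tendsto_0:
  assumes "0 \<le> q" "q < (1::real)"
  shows "(\<lambda>n. real (Suc n) ^ k * q ^ n) \<longlonglongrightarrow> 0"
proof -
  define r where "r = root (Suc k) q"
  have r: "0 \<le> r" "r < 1" "r ^ Suc k = q"
    using assms by (auto simp: r_def real_root_pow_pos2 simp del: power_Suc)
  have "(\<lambda>n. real n * r ^ n + r ^ n) \<longlonglongrightarrow> 0 + 0"
    using r powser_times_n_limit_0[of r] by (intro tendsto_add LIMSEQ_power_zero) auto
  then have "(\<lambda>n. (real n * r ^ n + r ^ n) ^ Suc k) \<longlonglongrightarrow> (0 + 0) ^ Suc k"
    by (rule tendsto_power)
  moreover have "(real n * r ^ n + r ^ n) ^ Suc k = real (Suc n) ^ Suc k * q ^ n" for n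
  proof -
    have "real n * r ^ n + r ^ n = real (Suc n) * r ^ n" by (simp add: algebra_simps)
    moreover have "(r ^ n) ^ Suc k = q ^ n"
      unfolding r(3)[symmetric] by (simp only: power_mult[symmetric] mult.commute)
    ultimately show ?thesis by (simp only: power_mult_distrib)
  qed
  ultimately have lim: "(\<lambda>n. real (Suc n) ^ Suc k * q ^ n) \<longlonglongrightarrow> 0"
    by simp
  show ?thesis
  proof (rule tendsto_sandwich[OF _ _ tendsto_const lim])
    show "\<forall>\<^sub>F n in sequentially. real (Suc n) ^ k * q ^ n \<le> real (Suc n) ^ Suc k * q ^ n"
      using assms by (intro always_eventually allI mult_right_mono power_increasing) auto
  qed (use assms in auto)
qed

section \<open>Bohr sets and their polars\<close>

definition bohr :: "'a::topological_ab_group_add set \<Rightarrow> real \<Rightarrow> 'a dual set"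
  where "bohr F e = {\<phi>. \<forall>h\<in>F. cmod (ev \<phi> h - 1) < e}"

definition polar :: "'a::topological_ab_group_add dual set \<Rightarrow> real \<Rightarrow> 'a set"
  where "polar B r = {x. \<forall>\<phi>\<in>B. cmod (ev \<phi> x - 1) \<le> r}"

lemma norm_mult_minus_one_le:
  fixes a b :: complex
  assumes "cmod a = 1"
  shows "cmod (a * b - 1) \<le> cmod (a - 1) + cmod (b - 1)"
proof -
  have "a * b - 1 = a * (b - 1) + (a - 1)" by (simp add: algebra_simps)
  also have "cmod \<dots> \<le> cmod (a * (b - 1)) + cmod (a - 1)" by (rule norm_triangle_ineq)
  finally show ?thesis using assms by (simp add: norm_mult)
qed

locale separated_group =
  fixes type :: "'a::topological_ab_group_add itself"
  assumes separated: "(x::'a) \<noteq> 0 \<Longrightarrow> \<exists>\<phi>. ev \<phi> x \<noteq> 1"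
begin

lemma has_mean_ev: "has_mean (\<lambda>\<phi>. ev \<phi> (x::'a)) (if x = 0 then 1 else 0)"
  using separated[of x] has_mean_ev_nonzero[of _ x] has_mean_const[of 1] by auto

lemma has_mean_kernel:
  assumes "finite (F :: 'a set)"
  shows "has_mean (\<lambda>\<phi>. cmod (binomial_kernel F \<phi>) ^ (2 * N) * Re (ev \<phi> x)) (kernel_coeff F N x)"
proof -
  define I where "I = exponents F N"
  define c where "c n m = complex_of_real (binomial_weight F N n) * complex_of_real (binomial_weight F N m)" for n m
  have expand: "(cmod (binomial_kernel F \<phi>) ^ (2 * N)) *\<^sub>R ev \<phi> x
    = (\<Sum>n\<in>I. \<Sum>m\<in>I. c n m * ev \<phi> (combination F n - combination F m + x))" for \<phi>
  proof -
    have "complex_of_real (cmod (binomial_kernel F \<phi>) ^ (2 * N))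
        = binomial_kernel F \<phi> ^ N * cnj (binomial_kernel F \<phi> ^ N)"
      unfolding complex_norm_square[symmetric] norm_power power_mult[symmetric] mult.commute[of 2 N] ..
    also have "\<dots> = (\<Sum>n\<in>I. \<Sum>m\<in>I. c n m * ev \<phi> (combination F n - combination F m))"
      unfolding binomial_kernel_power[OF assms] I_def[symmetric] cnj_sum sum_product
      by (simp add: c_def ev_diff mult_ac)
    finally show ?thesis
      by (simp add: scaleR_conv_of_real sum_distrib_right ev_add mult.assoc)
  qed
  have "has_mean (\<lambda>\<phi>. \<Sum>n\<in>I. \<Sum>m\<in>I. c n m * ev \<phi> (combination F n - combination F m + x))
      (\<Sum>n\<in>I. \<Sum>m\<in>I. c n m * (if combination F n - combination F m + x = 0 then 1 else 0))"
    by (intro has_mean_sum has_mean_mult_left has_mean_ev)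
  from has_mean_bounded_linear[OF bounded_linear_Re this[folded expand]]
  show ?thesis
    by (simp add: kernel_coeff_def I_def c_def Re_sum if_distrib cong: if_cong)
qed

text \<open>For \<open>x\<close> in the polar, the characters in the Bohr set have real part at
  least \<open>1 / 2\<close> at \<open>x\<close>, while off it the kernel power is at most
  \<open>q ^ N\<close>. So the coefficient at \<open>x\<close> is at least half of that at zero up
  to an exponentially small error; being nonzero, it exhibits \<open>x\<close> as a difference of
  exponents.\<close>

lemma polar_bohr_finite:
  assumes F: "finite (F :: 'a set)" and e: "0 < e" "e \<le> 1"
  obtains N where "polar (bohr F e) 1
    \<subseteq> (\<lambda>(n, m). combination F m - combination F n) ` (exponents F N \<times> exponents F N)"
proof -
  \<comment> \<open>For \<open>cmod z = 1\<close>, the square of \<open>cmod ((1 + z) / 2)\<close>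
    is \<open>1 - (cmod (z - 1))\<^sup>2 / 4\<close>, so a factor with
    \<open>cmod (z - 1) \<ge> e\<close> has square at most \<open>q\<close>.\<close>
  define q where "q = 1 - e\<^sup>2 / 4"
  have "e\<^sup>2 \<le> 1" using e by (simp add: power_le_one)
  then have q: "0 \<le> q" "q < 1" using e by (auto simp: q_def)
  \<comment> \<open>The threshold \<open>1 / 3\<close> and the polynomial lower bound on the
    coefficient at zero combine to \<open>3 * q ^ N < c 0\<close>.\<close>
  have "\<forall>\<^sub>F N in sequentially. real (Suc N) ^ (2 * card F) * q ^ N < 1 / 3"
    by (rule order_tendstoD(2)[OF poly_times_geometric_tendsto_0[OF q]]) simp
  then obtain N where N: "real (Suc N) ^ (2 * card F) * q ^ N < 1 / 3"
    unfolding eventually_sequentially by blast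
  define c where "c = kernel_coeff F N"
  have "3 / 2 * q ^ N < c 0 / 2"
  proof -
    have "real (Suc N) ^ (2 * card F) * (3 * q ^ N) = 3 * (real (Suc N) ^ (2 * card F) * q ^ N)"
      by (rule mult.left_commute)
    also have "\<dots> < real (Suc N) ^ (2 * card F) * c 0"
      using N kernel_coeff_zero_ge[OF F, of N] unfolding c_def by linarith
    finally have "real (Suc N) ^ (2 * card F) * (3 * q ^ N) < real (Suc N) ^ (2 * card F) * c 0" .
    then have "3 * q ^ N < c 0" by (rule mult_left_less_imp_less) simp
    then show ?thesis by simp
  qed
  \<comment> \<open>The last summand makes the averaged function nonnegative off the Bohr set as
    well, where \<open>Re (ev \<phi> x) - 1 / 2\<close> can be as low as
    \<open>- 3 / 2\<close>.\<close>
  moreover have "0 \<le> c x - 1 / 2 * c 0 + 3 / 2 * q ^ N" if x: "x \<in> polar (bohr F e) 1" for x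
  proof (rule has_mean_nonneg)
    define K where "K \<phi> = cmod (binomial_kernel F \<phi>) ^ (2 * N)" for \<phi>
    show "has_mean (\<lambda>\<phi>. K \<phi> * Re (ev \<phi> x) - 1 / 2 * (K \<phi> * Re (ev \<phi> 0)) + 3 / 2 * q ^ N)
        (c x - 1 / 2 * c 0 + 3 / 2 * q ^ N)"
      unfolding c_def K_def
      by (intro has_mean_add has_mean_diff has_mean_mult_left has_mean_const has_mean_kernel F)
    fix \<phi>
    have K0: "0 \<le> K \<phi>" by (simp add: K_def)
    have le1: "cmod ((1 + ev \<phi> h) / 2) \<le> 1" for h
      using norm_triangle_ineq[of 1 "ev \<phi> h"] by (simp add: norm_divide)
    show "0 \<le> K \<phi> * Re (ev \<phi> x) - 1 / 2 * (K \<phi> * Re (ev \<phi> 0)) + 3 / 2 * q ^ N"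
    proof (cases "\<phi> \<in> bohr F e")
      case True
      then have "cmod (ev \<phi> x - 1) \<le> 1" using x by (auto simp: polar_def)
      then have "(cmod (ev \<phi> x - 1))\<^sup>2 \<le> 1" by (simp add: power_le_one)
      moreover have "(cmod (ev \<phi> x))\<^sup>2 = 1" by simp
      ultimately have "1 / 2 \<le> Re (ev \<phi> x)"
        unfolding cmod_power2 by (simp add: power2_eq_square algebra_simps)
      then have "0 \<le> K \<phi> * (Re (ev \<phi> x) - 1 / 2)" using K0 by simp
      then show ?thesis using zero_le_power[OF q(1), of N] by (simp add: algebra_simps)
    next
      case False
      then obtain h where h: "h \<in> F" "e \<le> cmod (ev \<phi> h - 1)" by (auto simp: bohr_def not_less)
      have "(cmod ((1 + ev \<phi> h) / 2))\<^sup>2 = 1 - (cmod (ev \<phi> h - 1))\<^sup>2 / 4"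
      proof -
        have "(cmod (ev \<phi> h))\<^sup>2 = 1" by simp
        then show ?thesis
          unfolding norm_divide power_divide cmod_power2
          by (simp add: power2_eq_square field_simps)
      qed
      also have "\<dots> \<le> q" using h e by (simp add: q_def power_mono)
      finally have hq: "(cmod ((1 + ev \<phi> h) / 2))\<^sup>2 \<le> q" .
      have "binomial_kernel F \<phi> = (1 + ev \<phi> h) / 2 * (\<Prod>h\<in>F - {h}. (1 + ev \<phi> h) / 2)"
        unfolding binomial_kernel_def by (rule prod.remove[OF F h(1)])
      then have "cmod (binomial_kernel F \<phi>)
          = cmod ((1 + ev \<phi> h) / 2) * (\<Prod>h\<in>F - {h}. cmod ((1 + ev \<phi> h) / 2))"
        by (simp only: norm_mult prod_norm)
      also have "\<dots> \<le> cmod ((1 + ev \<phi> h) / 2) * 1"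
        by (intro mult_left_mono prod_le_1) (use le1 in auto)
      finally have "(cmod (binomial_kernel F \<phi>))\<^sup>2 \<le> (cmod ((1 + ev \<phi> h) / 2))\<^sup>2"
        by (intro power_mono) auto
      with hq have "(cmod (binomial_kernel F \<phi>))\<^sup>2 \<le> q" by linarith
      then have Kq: "K \<phi> \<le> q ^ N" unfolding K_def power_mult by (intro power_mono) auto
      have "- 1 \<le> Re (ev \<phi> x)" using abs_Re_le_cmod[of "ev \<phi> x"] by simp
      then have "K \<phi> * (- 3 / 2) \<le> K \<phi> * (Re (ev \<phi> x) - 1 / 2)"
        using K0 by (intro mult_left_mono) auto
      then show ?thesis using Kq by (simp add: algebra_simps)
    qed
  qed
  ultimately have "c x \<noteq> 0" if "x \<in> polar (bohr F e) 1" for x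
    using that by force
  then have "polar (bohr F e) 1
    \<subseteq> (\<lambda>(n, m). combination F m - combination F n) ` (exponents F N \<times> exponents F N)"
    using kernel_coeff_nonzero[of F N] unfolding c_def by fastforce
  then show ?thesis using that by blast
qed

lemma finite_polar_bohr:
  assumes "finite (F :: 'a set)" "0 < e" "e \<le> 1"
  shows "finite (polar (bohr F e) 1)"
proof -
  obtain N where "polar (bohr F e) 1
    \<subseteq> (\<lambda>(n, m). combination F m - combination F n) ` (exponents F N \<times> exponents F N)"
    by (rule polar_bohr_finite[OF assms])
  then show ?thesis
    by (rule finite_subset) (intro finite_imageI finite_cartesian_product finite_PiE assms; simp)
qed

lemma polar_bohr_subgroup:
  assumes "finite (F :: 'a set)" "0 < e" "e \<le> 1" "is_subgroup H" "F \<subseteq> H"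
  shows "polar (bohr F e) 1 \<subseteq> H"
proof -
  have add: "x + y \<in> H" if "x \<in> H" "y \<in> H" for x y using assms(4) that by (simp add: is_subgroup_def)
  have zero: "0 \<in> H" using assms(4) by (simp add: is_subgroup_def)
  have neg: "- x \<in> H" if "x \<in> H" for x using assms(4) that by (simp add: is_subgroup_def)
  have mult: "multiple k x \<in> H" if "x \<in> H" for k x
    by (induction k) (auto simp: multiple_def zero intro: add that)
  have "(\<Sum>h\<in>G. multiple (n h) h) \<in> H" if "G \<subseteq> H" for G n
    using that by (induction G rule: infinite_finite_induct) (auto intro: zero add mult)
  then have "combination F n \<in> H" for n using assms(5) by (simp add: combination_def)
  then have diff: "combination F m - combination F n \<in> H" for n m
    using add[OF _ neg] by fastforce
  obtain N where "polar (bohr F e) 1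
    \<subseteq> (\<lambda>(n, m). combination F m - combination F n) ` (exponents F N \<times> exponents F N)"
    by (rule polar_bohr_finite[OF assms(1-3)])
  then show ?thesis using diff by auto
qed

text \<open>If the set were finite, one further point for each nonzero member, detecting its
  nontriviality, and a smaller radius would cut it down to zero. The polar would then be the whole
  infinite group, against \<open>finite_polar_bohr\<close>.\<close>

lemma infinite_bohr:
  assumes "infinite (UNIV :: 'a set)" "finite (F :: 'a set)" "0 < e"
  shows "infinite (bohr F e)"
proof
  assume fin: "finite (bohr F e)"
  have "\<forall>\<phi>. \<exists>x. \<phi> \<noteq> 0 \<longrightarrow> ev \<phi> x \<noteq> (1::complex)" using ev_nontrivial by metis
  from choice[OF this] obtain y where y: "\<And>\<phi>. \<phi> \<noteq> 0 \<Longrightarrow> ev \<phi> (y \<phi> :: 'a) \<noteq> 1" by blast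
  define B where "B = bohr F e - {0}"
  \<comment> \<open>Including \<open>e\<close> keeps the new Bohr set inside the old one, and
    including one meets the radius bound of \<open>finite_polar_bohr\<close>.\<close>
  define d where "d = Min (insert (min e 1) ((\<lambda>\<phi>. cmod (ev \<phi> (y \<phi>) - 1)) ` B))"
  have finB: "finite B" using fin by (simp add: B_def)
  have d: "0 < d" "d \<le> e" "d \<le> 1" "\<And>\<phi>. \<phi> \<in> B \<Longrightarrow> d \<le> cmod (ev \<phi> (y \<phi>) - 1)"
  proof -
    show "0 < d" unfolding d_def using finB y \<open>0 < e\<close> by (subst Min_gr_iff) (auto simp: B_def)
    have "d \<le> min e 1" unfolding d_def using finB by (intro Min_le) auto
    then show "d \<le> e" "d \<le> 1" by auto
    show "d \<le> cmod (ev \<phi> (y \<phi>) - 1)" if "\<phi> \<in> B" for \<phi>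
      unfolding d_def using finB that by (intro Min_le) auto
  qed
  have "\<phi> = 0" if "\<phi> \<in> bohr (F \<union> y ` B) d" for \<phi>
  proof (rule ccontr)
    assume "\<phi> \<noteq> 0"
    have "\<phi> \<in> bohr F e" using that d(2) by (force simp: bohr_def)
    with \<open>\<phi> \<noteq> 0\<close> have "\<phi> \<in> B" by (simp add: B_def)
    then have "cmod (ev \<phi> (y \<phi>) - 1) < d" using that by (simp add: bohr_def)
    with d(4)[OF \<open>\<phi> \<in> B\<close>] show False by simp
  qed
  then have "polar (bohr (F \<union> y ` B) d) 1 = UNIV" by (force simp: polar_def)
  moreover have "finite (polar (bohr (F \<union> y ` B) d) 1)"
    using assms(2) finB d by (intro finite_polar_bohr) auto
  ultimately show False using assms(1) by simp
qed

text \<open>Each \<open>\<phi>\<close> in the smaller Bohr set is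
  \<open>(\<psi> + \<phi>) - \<psi>\<close> with both terms in the larger one. As infinitely many
  \<open>\<psi>\<close> are available, both terms can avoid \<open>E\<close>, and two errors of
  \<open>1 / 2\<close> add up to one.\<close>

lemma polar_bohr_diff_finite:
  assumes "infinite (UNIV :: 'a set)" "finite (F :: 'a set)" "0 < e" "finite E"
  shows "polar (bohr F e - E) (1 / 2) \<subseteq> polar (bohr F (e / 2)) 1"
proof
  fix x assume x: "x \<in> polar (bohr F e - E) (1 / 2)"
  show "x \<in> polar (bohr F (e / 2)) 1"
    unfolding polar_def
  proof (intro CollectI ballI)
    fix \<phi> assume \<phi>: "\<phi> \<in> bohr F (e / 2)"
    have "infinite (bohr F (e / 2) - (E \<union> (\<lambda>\<psi>. \<psi> - \<phi>) ` E))"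
      using assms by (intro Diff_infinite_finite infinite_bohr) auto
    from infinite_imp_nonempty[OF this] obtain \<psi> where
      \<psi>: "\<psi> \<in> bohr F (e / 2)" "\<psi> \<notin> E" "\<psi> \<notin> (\<lambda>\<psi>. \<psi> - \<phi>) ` E"
      by blast
    have "\<psi> + \<phi> \<notin> E"
    proof
      assume "\<psi> + \<phi> \<in> E"
      then have "(\<psi> + \<phi>) - \<phi> \<in> (\<lambda>\<psi>. \<psi> - \<phi>) ` E" by blast
      with \<psi>(3) show False by simp
    qed
    moreover have "\<psi> + \<phi> \<in> bohr F e"
      unfolding bohr_def
    proof (intro CollectI ballI)
      fix h assume "h \<in> F"
      then have "cmod (ev \<psi> h - 1) < e / 2" "cmod (ev \<phi> h - 1) < e / 2"
        using \<phi> \<psi> by (auto simp: bohr_def)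
      then show "cmod (ev (\<psi> + \<phi>) h - 1) < e"
        using norm_mult_minus_one_le[of "ev \<psi> h" "ev \<phi> h"] by (simp add: ev_plus)
    qed
    ultimately have "cmod (ev (\<psi> + \<phi>) x - 1) \<le> 1 / 2" using x by (simp add: polar_def)
    moreover have "\<psi> \<in> bohr F e" using \<psi>(1) \<open>0 < e\<close> by (force simp: bohr_def)
    then have "cmod (ev \<psi> x - 1) \<le> 1 / 2" using x \<psi>(2) by (simp add: polar_def)
    moreover have "cmod (ev \<phi> x - 1) \<le> cmod (ev (\<psi> + \<phi>) x - 1) + cmod (ev \<psi> x - 1)"
    proof -
      have "ev \<psi> x * (ev \<phi> x - 1) = (ev (\<psi> + \<phi>) x - 1) - (ev \<psi> x - 1)"
        by (simp add: ev_plus algebra_simps)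
      then have "cmod (ev \<psi> x * (ev \<phi> x - 1)) \<le> cmod (ev (\<psi> + \<phi>) x - 1) + cmod (ev \<psi> x - 1)"
        using norm_triangle_ineq4 by metis
      then show ?thesis by (simp add: norm_mult)
    qed
    ultimately show "cmod (ev \<phi> x - 1) \<le> 1" by linarith
  qed
qed

end

section \<open>The characterizing set\<close>

text \<open>At each point outside the open set \<open>W\<close> of points \<open>U\<close>-close to
  the polar, some available character has distance more than \<open>1 / 2\<close> from one. The
  complement of \<open>W\<close> is compact, so finitely many characters suffice.\<close>

lemma (in separated_group) finite_subset_polar:
  assumes compact: "compact (UNIV :: 'a set)" and inf: "infinite (UNIV :: 'a set)"
    and F: "finite (F :: 'a set)" and e: "0 < e" and "finite E" and U: "open U" "(0::'a) \<in> U"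
  shows "\<exists>B. finite B \<and> B \<noteq> {} \<and> B \<subseteq> bohr F e - E
    \<and> (\<forall>x\<in>polar B (1 / 2). \<exists>p\<in>polar (bohr F (e / 2)) 1. x - p \<in> U)"
proof -
  define W where "W = (\<Union>p\<in>polar (bohr F (e / 2)) 1. (\<lambda>x. x - p) -` U)"
  have "open W"
    unfolding W_def by (intro open_UN ballI open_vimage U continuous_intros)
  then have "compact (- W)"
    using compact_Int_closed[OF compact, of "- W"] by (simp add: closed_Compl)
  moreover have "open {x::'a. 1 / 2 < cmod (ev \<phi> x - 1)}" for \<phi>
    by (intro open_Collect_less continuous_intros continuous_ev)
  moreover have "- W \<subseteq> (\<Union>\<phi>\<in>bohr F e - E. {x. 1 / 2 < cmod (ev \<phi> x - 1)})"
  proof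
    fix x assume x: "x \<in> - W"
    show "x \<in> (\<Union>\<phi>\<in>bohr F e - E. {x. 1 / 2 < cmod (ev \<phi> x - 1)})"
    proof (rule ccontr)
      assume "\<not> ?thesis"
      then have "x \<in> polar (bohr F e - E) (1 / 2)" by (auto simp: polar_def not_less)
      then have "x \<in> polar (bohr F (e / 2)) 1"
        using polar_bohr_diff_finite[OF inf F e \<open>finite E\<close>] by blast
      moreover have "x - x \<in> U" using U by simp
      ultimately have "x \<in> W" unfolding W_def by blast
      with x show False by simp
    qed
  qed
  ultimately obtain D where D: "D \<subseteq> bohr F e - E" "finite D"
      "- W \<subseteq> (\<Union>\<phi>\<in>D. {x. 1 / 2 < cmod (ev \<phi> x - 1)})"
    by (rule compactE_image)
  \<comment> \<open>An extra character keeps the block nonempty even if \<open>D\<close> is empty;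
    the union of all blocks is infinite for this reason.\<close>
  have "infinite (bohr F e - E)"
    using infinite_bohr[OF inf F e] \<open>finite E\<close> by simp
  from infinite_imp_nonempty[OF this] obtain \<psi> where \<psi>: "\<psi> \<in> bohr F e - E" by blast
  have "\<exists>p\<in>polar (bohr F (e / 2)) 1. x - p \<in> U" if x: "x \<in> polar (insert \<psi> D) (1 / 2)" for x
  proof -
    have "x \<notin> (\<Union>\<phi>\<in>D. {x. 1 / 2 < cmod (ev \<phi> x - 1)})"
      using x by (auto simp: polar_def not_less)
    with D(3) have "x \<in> W" by blast
    then show ?thesis by (auto simp: W_def)
  qed
  with D \<psi> show ?thesis by (intro exI[of _ "insert \<psi> D"]) auto
qed

text \<open>Continuity of subtraction at the origin. With \<open>S\<close> the nonzero differences
  of two finite sets, a point cannot be \<open>U\<close>-close to distinct elements of them.\<close>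

lemma open_difference_avoids_finite:
  fixes S :: "'a::{topological_ab_group_add, t1_space} set"
  assumes "finite S" "0 \<notin> S"
  obtains U where "open U" "0 \<in> U" "\<And>x y. x \<in> U \<Longrightarrow> y \<in> U \<Longrightarrow> x - y \<notin> S"
proof -
  define f :: "'a \<times> 'a \<Rightarrow> 'a" where "f p = fst p + - snd p" for p
  have "open (f -` (- S))"
    unfolding f_def using assms(1)
    by (intro open_vimage continuous_on_add continuous_on_fst continuous_on_snd continuous_on_id
        continuous_on_compose2[OF continuous_on_minus[OF continuous_on_id]] open_Compl finite_imp_closed)
      auto
  moreover have "(0, 0) \<in> f -` (- S)" using assms by (simp add: f_def)
  ultimately obtain A B where AB: "open A" "open B" "0 \<in> A" "0 \<in> B" "A \<times> B \<subseteq> f -` (- S)"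
    by (rule open_prod_elim) blast
  show ?thesis
  proof (rule that)
    show "open (A \<inter> B)" "0 \<in> A \<inter> B" using AB by auto
    fix x y assume "x \<in> A \<inter> B" "y \<in> A \<inter> B"
    then have "(x, y) \<in> f -` (- S)" using AB(5) by blast
    then show "x - y \<notin> S" by (simp add: f_def)
  qed
qed

lemma countable_base_at_zero:
  assumes "metrizable_space (euclidean :: 'a::{topological_ab_group_add, t2_space} topology)"
  obtains G :: "nat \<Rightarrow> 'a::{topological_ab_group_add, t2_space} set" where
    "\<And>n. open (G n)" "\<And>n. 0 \<in> G n" "\<And>U. open U \<Longrightarrow> 0 \<in> U \<Longrightarrow> \<exists>n. G n \<subseteq> U"
proof -
  have "first_countable (euclidean :: 'a topology)"
    using assms by (rule metrizable_imp_first_countable)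
  then have "\<exists>\<B>. countable \<B> \<and> (\<forall>V\<in>\<B>. open V)
      \<and> (\<forall>U. open U \<and> (0::'a) \<in> U \<longrightarrow> (\<exists>V\<in>\<B>. 0 \<in> V \<and> V \<subseteq> U))"
    unfolding first_countable_def by simp
  then obtain \<B> where \<B>: "countable \<B>" "\<forall>V\<in>\<B>. open V"
    "\<forall>U. open U \<and> (0::'a) \<in> U \<longrightarrow> (\<exists>V\<in>\<B>. 0 \<in> V \<and> V \<subseteq> U)"
    by blast
  define \<C> where "\<C> = {V \<in> \<B>. 0 \<in> V}"
  have \<C>: "countable \<C>" "\<C> \<noteq> {}"
    using \<B>(1) \<B>(3)[rule_format, of UNIV] by (auto simp: \<C>_def)
  have mem: "from_nat_into \<C> n \<in> \<C>" for n
    using from_nat_into[OF \<C>(2)] .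
  show ?thesis
  proof (rule that)
    show "open (from_nat_into \<C> n)" "0 \<in> from_nat_into \<C> n" for n
      using mem[of n] \<B>(2) by (auto simp: \<C>_def)
    show "\<exists>n. from_nat_into \<C> n \<subseteq> U" if U: "open U" "0 \<in> U" for U
    proof -
      obtain V where "V \<in> \<C>" "V \<subseteq> U" using \<B>(3) U by (auto simp: \<C>_def)
      with from_nat_into_surj[OF \<C>(1)] show ?thesis by metis
    qed
  qed
qed

text \<open>\<open>circle_exp\<close> is continuous and closed and sends only zero to one, so
  neighbourhoods of zero in the circle and discs about one determine each other; injectivity of
  \<open>dual_fun\<close> transfers finiteness.\<close>

lemma char_subgroup_dual_iff:
  "x \<in> char_subgroup (dual_fun ` B) \<longleftrightarrow> (\<forall>e>0. finite {\<phi>\<in>B. e \<le> cmod (ev \<phi> x - 1)})"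
proof -
  have image: "{f \<in> dual_fun ` B. f x \<notin> U} = dual_fun ` {\<phi>\<in>B. dual_fun \<phi> x \<notin> U}" for U
    by blast
  have fin: "finite {f \<in> dual_fun ` B. f x \<notin> U} \<longleftrightarrow> finite {\<phi>\<in>B. dual_fun \<phi> x \<notin> U}" for U
    unfolding image by (intro finite_image_iff inj_onI) (simp add: dual_fun_inject)
  show ?thesis
  proof
    assume "x \<in> char_subgroup (dual_fun ` B)"
    then have *: "finite {\<phi>\<in>B. dual_fun \<phi> x \<notin> U}" if "open U" "0 \<in> U" for U
      using that by (simp add: char_subgroup_def fin)
    show "\<forall>e>0. finite {\<phi>\<in>B. e \<le> cmod (ev \<phi> x - 1)}"
    proof (intro allI impI)
      fix e :: real assume "e > 0"
      have "open {t. cmod (circle_exp t - 1) < e}"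
        by (intro open_Collect_less continuous_intros continuous_circle_exp)
      from *[OF this] \<open>e > 0\<close> show "finite {\<phi>\<in>B. e \<le> cmod (ev \<phi> x - 1)}"
        by (simp add: ev_def not_less)
    qed
  next
    assume *: "\<forall>e>0. finite {\<phi>\<in>B. e \<le> cmod (ev \<phi> x - 1)}"
    have "finite {\<phi>\<in>B. dual_fun \<phi> x \<notin> U}" if U: "open U" "0 \<in> U" for U
    proof -
      have "open (- circle_exp ` (- U))" "1 \<in> - circle_exp ` (- U)"
        using closed_circle_exp_image[of "- U"] U circle_exp_eq_1_iff by (auto simp: image_iff dest: sym)
      then obtain e where e: "e > 0" "ball 1 e \<subseteq> - circle_exp ` (- U)"
        by (rule openE)
      have "{\<phi>\<in>B. dual_fun \<phi> x \<notin> U} \<subseteq> {\<phi>\<in>B. e \<le> cmod (ev \<phi> x - 1)}"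
      proof safe
        fix \<phi> assume "dual_fun \<phi> x \<notin> U"
        then have "ev \<phi> x \<notin> ball 1 e" using e(2) by (auto simp: ev_def)
        then show "e \<le> cmod (ev \<phi> x - 1)" by (simp add: dist_norm norm_minus_commute)
      qed
      then show ?thesis using * e(1) finite_subset by blast
    qed
    then show "x \<in> char_subgroup (dual_fun ` B)" by (simp add: char_subgroup_def fin)
  qed
qed

theorem theorem1p4:
  fixes H :: "'a::{topological_ab_group_add, t2_space} set"
  assumes "compact (UNIV :: 'a set)"
    and "metrizable_space (euclidean :: 'a topology)"
    and "is_subgroup H"
    and "countable H" and "infinite H"
  shows "\<exists>B. B \<subseteq> dual_group \<and> countable B \<and> infinite B \<and> H = char_subgroup B"
proof -
  interpret compact_group "TYPE('a)" by unfold_locales (rule assms(1))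
  interpret separated_group "TYPE('a)"
    by unfold_locales (rule ev_separates[OF metrizable_imp_normal_space[OF assms(2)]])
  have inf: "infinite (UNIV :: 'a set)" using assms(5) infinite_super subset_UNIV by blast
  define F where "F n = from_nat_into H ` {..n}" for n :: nat
  define e :: "nat \<Rightarrow> real" where "e n = 1 / 2 ^ n" for n
  \<comment> \<open>The radius is halved because \<open>finite_subset_polar\<close> controls a block
    inside \<open>bohr (F n) (e n)\<close> by the polar for half its radius.\<close>
  define P where "P n = polar (bohr (F n) (e n / 2)) 1" for n
  have F: "finite (F n)" "F n \<subseteq> H" for n
    using from_nat_into[of H] assms(5) by (auto simp: F_def)
  have mem_F: "\<exists>n. \<forall>m\<ge>n. h \<in> F m" if h: "h \<in> H" for h
  proof -
    obtain n where "from_nat_into H n = h" using from_nat_into_surj[OF assms(4) h] by blast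
    then have "\<forall>m\<ge>n. h \<in> F m" by (auto simp: F_def)
    then show ?thesis ..
  qed
  have e: "0 < e n" "0 < e n / 2" "e n / 2 \<le> 1" for n
  proof -
    have "(1::real) \<le> 2 ^ n" by (rule one_le_power) simp
    then have "e n \<le> 1" by (simp add: e_def)
    moreover show "0 < e n" "0 < e n / 2" by (simp_all add: e_def)
    ultimately show "e n / 2 \<le> 1" by linarith
  qed
  have P: "finite (P n)" "P n \<subseteq> H" for n
    unfolding P_def
    by (rule finite_polar_bohr[OF F(1) e(2,3)], rule polar_bohr_subgroup[OF F(1) e(2,3) assms(3) F(2)])
  obtain G :: "nat \<Rightarrow> 'a set" where G: "\<And>n. open (G n)" "\<And>n. 0 \<in> G n"
    "\<And>U. open U \<Longrightarrow> 0 \<in> U \<Longrightarrow> \<exists>n. G n \<subseteq> U"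
    using countable_base_at_zero[OF assms(2)] by blast
  \<comment> \<open>If the differences of a neighbourhood avoid \<open>S n\<close>, it cannot
    contain \<open>x - q n\<close> and \<open>x - q (Suc n)\<close> for distinct candidates from
    \<open>P n\<close> and \<open>P (Suc n)\<close>.\<close>
  define S where "S n = (\<lambda>(p, q). p - q) ` (P (Suc n) \<times> P n) - {0}" for n
  have "\<forall>n. \<exists>V. open V \<and> 0 \<in> V \<and> (\<forall>x\<in>V. \<forall>y\<in>V. x - y \<notin> S n)"
  proof
    fix n
    have "finite (S n)" "0 \<notin> S n" using P(1) by (auto simp: S_def)
    then show "\<exists>V. open V \<and> 0 \<in> V \<and> (\<forall>x\<in>V. \<forall>y\<in>V. x - y \<notin> S n)"
      using open_difference_avoids_finite by metis
  qed
  from choice[OF this] obtain V where V: "\<And>n. open (V n)" "\<And>n. 0 \<in> V n"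
    "\<And>n x y. x \<in> V n \<Longrightarrow> y \<in> V n \<Longrightarrow> x - y \<notin> S n" by blast
  \<comment> \<open>The intersection over \<open>k \<le> n\<close> puts \<open>U (Suc n)\<close>
    inside \<open>V n\<close> as well, as the comparison of stages \<open>n\<close> and
    \<open>Suc n\<close> requires; the sets \<open>G k\<close> make \<open>U n\<close> shrink to
    zero.\<close>
  define U where "U n = (\<Inter>k\<le>n. G k \<inter> V k)" for n
  have U: "open (U n)" "0 \<in> U n" for n
    using G V by (auto simp: U_def intro!: open_INT open_Int)
  have U_sub: "U m \<subseteq> G n" "U m \<subseteq> V n" if "n \<le> m" for n m
    using that by (auto simp: U_def)
  define good where "good n E B \<longleftrightarrow> finite B \<and> B \<noteq> {} \<and> B \<subseteq> bohr (F n) (e n) - E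
      \<and> (\<forall>x\<in>polar B (1 / 2). \<exists>q\<in>P n. x - q \<in> U n)" for n E B
  have "\<exists>B. good n E B" if "finite E" for n E
    unfolding good_def P_def by (rule finite_subset_polar[OF assms(1) inf F(1) e(1) that U])
  then have good: "good n E (SOME B. good n E B)" if "finite E" for n E
    using that by (blast intro: someI_ex)
  \<comment> \<open>\<open>E n\<close> collects the blocks with index below \<open>n\<close>;
    excluding it makes the blocks pairwise disjoint.\<close>
  define E where "E = rec_nat {} (\<lambda>n E. E \<union> (SOME B. good n E B))"
  define B where "B n = (SOME B. good n (E n) B)" for n
  have E_simps: "E 0 = {}" "E (Suc n) = E n \<union> B n" for n
    by (simp_all add: E_def B_def)
  have finE: "finite (E n)" for n
  proof (induction n)
    case (Suc n)
    then have "finite (B n)" using good[of "E n" n] by (simp add: B_def good_def)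
    then show ?case using Suc by (simp add: E_simps)
  qed (simp add: E_simps)
  have "good n (E n) (B n)" for n unfolding B_def by (rule good[OF finE])
  then have B: "finite (B n)" "B n \<noteq> {}" "B n \<subseteq> bohr (F n) (e n)" "B n \<inter> E n = {}"
    "\<forall>x\<in>polar (B n) (1 / 2). \<exists>q\<in>P n. x - q \<in> U n" for n
    unfolding good_def by blast+
  have B_sub_E: "B m \<subseteq> E n" if "m < n" for m n
    using that by (induction n) (auto simp: E_simps less_Suc_eq)
  have disjoint: "n = m" if "\<phi> \<in> B n" "\<phi> \<in> B m" for n m \<phi>
    using that B(4) B_sub_E by (metis disjoint_iff linorder_neqE_nat subsetD)
  define \<B> where "\<B> = (\<Union>n. B n)"
  \<comment> \<open>By disjointness a character lies in at most one block, so a finite exceptional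
    set is missed by all blocks of large index.\<close>
  have finitely_many_blocks: "finite {n. B n \<inter> A \<noteq> {}}" if A: "finite A" for A
  proof -
    have "{n. B n \<inter> A \<noteq> {}} \<subseteq> (\<lambda>\<phi>. THE n. \<phi> \<in> B n) ` A"
    proof
      fix n assume "n \<in> {n. B n \<inter> A \<noteq> {}}"
      then obtain \<phi> where \<phi>: "\<phi> \<in> B n" "\<phi> \<in> A" by blast
      then have "(THE n. \<phi> \<in> B n) = n" using disjoint by (intro the_equality) auto
      then show "n \<in> (\<lambda>\<phi>. THE n. \<phi> \<in> B n) ` A" using \<phi>(2) by force
    qed
    then show ?thesis using A finite_surj by blast
  qed
  have "infinite \<B>"
  proof
    assume "finite \<B>"
    then have "finite {n. B n \<inter> \<B> \<noteq> {}}" by (rule finitely_many_blocks)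
    moreover have "B n \<inter> \<B> \<noteq> {}" for n using B(2) by (auto simp: \<B>_def)
    ultimately show False by simp
  qed
  moreover have "countable \<B>"
    unfolding \<B>_def by (intro countable_UN countableI_type countable_finite B)
  moreover have "x \<in> char_subgroup (dual_fun ` \<B>)" if x: "x \<in> H" for x
    unfolding char_subgroup_dual_iff
  proof (intro allI impI)
    fix d :: real assume "d > 0"
    obtain n where n: "\<forall>m\<ge>n. x \<in> F m" using mem_F[OF x] by blast
    obtain k where k: "e k < d"
      using real_arch_pow_inv[OF \<open>d > 0\<close>, of "1 / 2"] by (auto simp: e_def power_one_over)
    \<comment> \<open>From index \<open>max n k\<close> on, \<open>x\<close> belongs to
      \<open>F m\<close> and \<open>e m < d\<close>, so exceptional characters come from the
      finitely many earlier blocks.\<close>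
    have "\<phi> \<in> E (max n k)" if \<phi>: "\<phi> \<in> B m" "d \<le> cmod (ev \<phi> x - 1)" for \<phi> m
    proof (rule ccontr)
      assume "\<phi> \<notin> E (max n k)"
      then have "\<not> m < max n k" using B_sub_E[of m "max n k"] \<phi>(1) by blast
      then have m: "n \<le> m" "k \<le> m" by auto
      have "e m \<le> e k" unfolding e_def using m(2) by (intro divide_left_mono power_increasing) auto
      moreover have "cmod (ev \<phi> x - 1) < e m"
        using B(3) \<phi>(1) n m(1) by (auto simp: bohr_def)
      ultimately show False using k \<phi>(2) by linarith
    qed
    then have "{\<phi>\<in>\<B>. d \<le> cmod (ev \<phi> x - 1)} \<subseteq> E (max n k)" by (auto simp: \<B>_def)
    then show "finite {\<phi>\<in>\<B>. d \<le> cmod (ev \<phi> x - 1)}" using finE finite_subset by blast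
  qed
  moreover have "x \<in> H" if x: "x \<in> char_subgroup (dual_fun ` \<B>)" for x
  proof -
    have "finite {\<phi>\<in>\<B>. 1 / 2 \<le> cmod (ev \<phi> x - 1)}"
      using x[unfolded char_subgroup_dual_iff, rule_format, of "1 / 2"] by simp
    then have "finite {n. B n \<inter> {\<phi>\<in>\<B>. 1 / 2 \<le> cmod (ev \<phi> x - 1)} \<noteq> {}}"
      by (rule finitely_many_blocks)
    then obtain k where k: "\<And>n. B n \<inter> {\<phi>\<in>\<B>. 1 / 2 \<le> cmod (ev \<phi> x - 1)} \<noteq> {} \<Longrightarrow> n < k"
      unfolding finite_nat_set_iff_bounded by blast
    \<comment> \<open>Blocks from index \<open>k\<close> on miss the characters at distance at least
      \<open>1 / 2\<close> from one at \<open>x\<close>, so \<open>x\<close> lies in their polars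
      and has a candidate in \<open>P n\<close> at every such stage.\<close>
    have "\<exists>q\<in>P n. x - q \<in> U n" if "k \<le> n" for n
    proof (rule B(5)[rule_format])
      have "B n \<inter> {\<phi>\<in>\<B>. 1 / 2 \<le> cmod (ev \<phi> x - 1)} = {}" using k[of n] that by force
      then show "x \<in> polar (B n) (1 / 2)" by (fastforce simp: polar_def \<B>_def)
    qed
    then have "\<forall>n. \<exists>q. k \<le> n \<longrightarrow> q \<in> P n \<and> x - q \<in> U n" by blast
    from choice[OF this] obtain q where q: "\<And>n. k \<le> n \<Longrightarrow> q n \<in> P n \<and> x - q n \<in> U n" by blast
    have step: "q (Suc n) = q n" if n: "k \<le> n" for n
    proof (rule ccontr)
      assume "q (Suc n) \<noteq> q n"
      then have "q (Suc n) - q n \<in> S n" unfolding S_def using q[of n] q[of "Suc n"] n by force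
      moreover have "x - q n \<in> V n" "x - q (Suc n) \<in> V n"
        using q[of n] q[of "Suc n"] n U_sub(2)[of n n] U_sub(2)[of n "Suc n"] by auto
      then have "(x - q n) - (x - q (Suc n)) \<notin> S n" by (rule V(3))
      ultimately show False by simp
    qed
    have const: "q n = q k" if "k \<le> n" for n
      using that by (induction n rule: dec_induct) (auto simp: step)
    \<comment> \<open>With the candidate constant, the difference lies in every \<open>G n\<close>;
      these sets form a base at zero and points are closed.\<close>
    have "x - q k = 0"
    proof (rule ccontr)
      assume "x - q k \<noteq> 0"
      then have "\<exists>n. G n \<subseteq> - {x - q k}" by (intro G(3)) auto
      then obtain n where n: "G n \<subseteq> - {x - q k}" by blast
      have "x - q (max k n) \<in> U (max k n)" using q[of "max k n"] by simp
      then have "x - q k \<in> G n" using const[of "max k n"] U_sub(1)[of n "max k n"] by auto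
      with n show False by blast
    qed
    then show "x \<in> H" using q[of k] P(2)[of k] by auto
  qed
  ultimately show ?thesis
    using dual_fun
    by (intro exI[of _ "dual_fun ` \<B>"])
       (auto simp: finite_image_iff inj_on_def dual_fun_inject)
qed

end
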